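(* Let $F$ be a field and let $f\colon \mathbb{N}\to \mathbb{N}$ be a subexponential function. Then there exists a finitely generated $F$-algebra $A$ which is a domain, with growth function $g_A$ (with respect to a suitable finite-dimensional generating subspace), such that $g_A(n)\geq f(n)$ for infinitely many $n$, and, for every $\varepsilon>0$, $g_A(n)\leq\exp\left(n^{\frac{3}{4}+\varepsilon}\right)$ for infinitely many $n$.
   Context: $\mathbb{N}=\{1,2,\dots\}$. A non-decreasing function $f\colon\mathbb{N}\to\mathbb{N}$ is subexponential if $\limsup_{n\to\infty}\sqrt[n]{f(n)}=1$. Algebras are associative; a domain is a (not necessarily commutative) nonzero ring without zero divisors. If an algebra $A$ over $F$ is generated by a finite-dimensional subspace $V$, its growth function with respect to $V$ is $g_A(n)=g_{A,V}(n)=\dim_F(F+V+V^2+\cdots+V^n)$. *)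

theory Defs
  imports
    "HOL-Algebra.Embedded_Algebras"
    "HOL-Algebra.Generated_Rings"
    "HOL-Algebra.Module"
    "HOL-Library.Extended_Real"
begin

text \<open>
  The locale \<^locale>\<open>algebra\<close> of the library requires the algebra to be commutative, and
  \<^locale>\<open>domain\<close> requires a commutative ring.  The next two locales are their
  noncommutative versions.
\<close>

locale assoc_algebra = module R M + ring M for R and M (structure) +
  assumes smult_mult_left:
      "\<lbrakk>a \<in> carrier R; x \<in> carrier M; y \<in> carrier M\<rbrakk> \<Longrightarrow>
      (a \<odot>\<^bsub>M\<^esub> x) \<otimes>\<^bsub>M\<^esub> y = a \<odot>\<^bsub>M\<^esub> (x \<otimes>\<^bsub>M\<^esub> y)"
    and smult_mult_right:
      "\<lbrakk>a \<in> carrier R; x \<in> carrier M; y \<in> carrier M\<rbrakk> \<Longrightarrow>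
      x \<otimes>\<^bsub>M\<^esub> (a \<odot>\<^bsub>M\<^esub> y) = a \<odot>\<^bsub>M\<^esub> (x \<otimes>\<^bsub>M\<^esub> y)"

locale noncomm_domain = ring R for R (structure) +
  assumes one_not_zero: "\<one> \<noteq> \<zero>"
    and integral: "\<lbrakk>a \<otimes> b = \<zero>; a \<in> carrier R; b \<in> carrier R\<rbrakk> \<Longrightarrow> a = \<zero> \<or> b = \<zero>"

text \<open>
  The copy of \<open>F\<close> inside \<open>A\<close>.  If \<open>A\<close> is nonzero, this is a subfield
  isomorphic to \<open>F\<close> whose left multiplication on \<open>A\<close> is the scalar multiplication, so
  dimensions over \<open>F\<close> are the library's dimensions over this subfield.
\<close>

definition scalars :: "('f, 'm) ring_scheme \<Rightarrow> ('f, 'a, 'n) module_scheme \<Rightarrow> 'a set"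
  where "scalars F A = (\<lambda>c. c \<odot>\<^bsub>A\<^esub> \<one>\<^bsub>A\<^esub>) ` carrier F"

definition linear_span ::
    "('f, 'm) ring_scheme \<Rightarrow> ('f, 'a, 'n) module_scheme \<Rightarrow> 'a set \<Rightarrow> 'a set"
  where "linear_span F A S = \<Inter> {U. submodule U F A \<and> S \<subseteq> U}"

fun subspace_power ::
    "('f, 'm) ring_scheme \<Rightarrow> ('f, 'a, 'n) module_scheme \<Rightarrow> 'a set \<Rightarrow> nat \<Rightarrow> 'a set"
  where
    "subspace_power F A V 0 = scalars F A"
  | "subspace_power F A V (Suc n) =
       linear_span F A {x \<otimes>\<^bsub>A\<^esub> v | x v. x \<in> subspace_power F A V n \<and> v \<in> V}"

text \<open>\<open>F + V + V\<^sup>2 + \<dots> + V\<^sup>n\<close>\<close>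

fun power_sum ::
    "('f, 'm) ring_scheme \<Rightarrow> ('f, 'a, 'n) module_scheme \<Rightarrow> 'a set \<Rightarrow> nat \<Rightarrow> 'a set"
  where
    "power_sum F A V 0 = subspace_power F A V 0"
  | "power_sum F A V (Suc n) = power_sum F A V n <+>\<^bsub>A\<^esub> subspace_power F A V (Suc n)"

definition growth ::
    "('f, 'm) ring_scheme \<Rightarrow> ('f, 'a, 'n) module_scheme \<Rightarrow> 'a set \<Rightarrow> nat \<Rightarrow> nat"
  where "growth F A V n = ring.dim A (scalars F A) (power_sum F A V n)"

definition fin_dim_generating_subspace ::
    "('f, 'm) ring_scheme \<Rightarrow> ('f, 'a, 'n) module_scheme \<Rightarrow> 'a set \<Rightarrow> bool"
  where "fin_dim_generating_subspace F A V \<longleftrightarrow>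
    submodule V F A \<and>
    ring.finite_dimension A (scalars F A) V \<and>
    generate_ring A (scalars F A \<union> V) = carrier A"

text \<open>
  Functions on \<open>{1, 2, \<dots>}\<close> are represented by functions on \<^typ>\<open>nat\<close> whose value at
  \<open>0\<close> is ignored.
\<close>

definition subexponential :: "(nat \<Rightarrow> nat) \<Rightarrow> bool"
  where "subexponential f \<longleftrightarrow>
    (\<forall>n\<ge>1. f n \<ge> 1) \<and> mono_on {1..} f \<and>
    limsup (\<lambda>n. ereal (root n (real (f n)))) = 1"

text \<open>
  HOL cannot quantify existentially over types, so the existence of a finitely generated algebra
  over a field with elements in \<open>'f\<close> is stated with carrier a subset of
  \<open>nat list \<Rightarrow> 'f\<close>.  This loses nothing: choosing words in the generators that
  form a basis identifies any such algebra with a space of finitely supported coefficient functions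
  on words.
\<close>

end

theory Submission
  imports
    Defs
    "HOL-Library.Poly_Mapping"
    "HOL-Library.Multiset_Order"
    "HOL-Library.Countable"
    "HOL-Real_Asymp.Real_Asymp"
begin

text \<open>
  For a semigroup \<open>B\<close>, the enveloping algebra of the Lie algebra of the semigroup ring of \<open>B\<close> has
  an explicit model that works in every characteristic: its basis consists of the finite
  multisets over \<open>B\<close>, and the product of two multisets is the sum over all partial matchings between
  them, where matched elements are multiplied in \<open>B\<close> and the others are kept (the product of normally
  ordered differential operators).  The terms of top size form the product of a polynomial ring,
  so this algebra is a domain; projecting to multisets of size one is a map onto the semigroup ring.
  If \<open>B\<close> is graded and generated in degree 1, the subalgebra generated by the letters therefore has
  growth at least the number of elements of \<open>B\<close> of degree \<open>n\<close>, and at most the number of multisets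
  over \<open>B\<close> of total degree at most \<open>n\<close>.

  The semigroup \<open>B\<close> consists of binary words in which no difference of two positions
  of the letter 1 lies in a forbidden set \<open>X\<close> which is a union of long intervals \<open>{D<..N}\<close>; all bad words
  of a given length are identified with each other, so that no zero is needed.  If \<open>D\<close> is large
  compared with the preceding \<open>N\<close>, there are at least \<open>f D\<close> words of length \<open>D\<close>.  The number of words
  of length \<open>m \<le> N\<close> is at most \<open>C * m\<close> for a constant \<open>C\<close> that depends only on \<open>D\<close>, so if \<open>N\<close> is large
  compared with \<open>D\<close>, the number of multisets of total length at most \<open>N\<close> is even
  \<open>exp (N\<^bsup>2/3 + o(1)\<^esup>)\<close>.
\<close>

section \<open>The normally ordered product of multisets\<close>


lemma sum_mset_remove1_add_mset:
  fixes h :: "'a \<Rightarrow> 'a multiset \<Rightarrow> 'b::comm_monoid_add"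
  shows "(\<Sum>c\<in>#add_mset x \<nu>. h c (add_mset x \<nu> - {#c#}))
    = h x \<nu> + (\<Sum>c\<in>#\<nu>. h c (add_mset x (\<nu> - {#c#})))"
proof -
  have "image_mset (\<lambda>c. h c (add_mset x \<nu> - {#c#})) \<nu>
      = image_mset (\<lambda>c. h c (add_mset x (\<nu> - {#c#}))) \<nu>"
    by (rule image_mset_cong) (metis add_mset_remove_trivial diff_union_swap insert_DiffM)
  then show ?thesis by simp
qed

text \<open>Both sides run over ordered pairs of different occurrences in \<open>\<nu>\<close>. In
  the induction step the pairs split into those with the new occurrence first, those with it second,
  and those without it; swapping exchanges the first two groups, and the induction hypothesis
  handles the third.\<close>

lemma sum_mset_remove2_swap:
  fixes g :: "'a \<Rightarrow> 'a \<Rightarrow> 'a multiset \<Rightarrow> 'b::comm_monoid_add"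
  shows "(\<Sum>c\<in>#\<nu>. \<Sum>d\<in>#\<nu> - {#c#}. g c d (\<nu> - {#c#} - {#d#}))
    = (\<Sum>c\<in>#\<nu>. \<Sum>d\<in>#\<nu> - {#c#}. g d c (\<nu> - {#c#} - {#d#}))"
proof (induction \<nu> arbitrary: g)
  case empty
  then show ?case by simp
next
  case (add x \<nu>)
  have *: "(\<Sum>c\<in>#add_mset x \<nu>. \<Sum>d\<in>#add_mset x \<nu> - {#c#}. k c d (add_mset x \<nu> - {#c#} - {#d#}))
    = (\<Sum>d\<in>#\<nu>. k x d (\<nu> - {#d#})) + (\<Sum>c\<in>#\<nu>. k c x (\<nu> - {#c#}))
      + (\<Sum>c\<in>#\<nu>. \<Sum>d\<in>#\<nu> - {#c#}. k c d (add_mset x (\<nu> - {#c#} - {#d#})))"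
    for k :: "'a \<Rightarrow> 'a \<Rightarrow> 'a multiset \<Rightarrow> 'b"
    by (simp only: sum_mset_remove1_add_mset[where h = "\<lambda>c \<kappa>. \<Sum>d\<in>#\<kappa>. k c d (\<kappa> - {#d#})"]
        sum_mset_remove1_add_mset sum_mset.distrib add.assoc)
  show ?case
    unfolding *[of g] *[of "\<lambda>c d. g d c"]
    using add.IH[of "\<lambda>c d \<kappa>. g c d (add_mset x \<kappa>)"]
    by (simp add: ac_simps)
qed

lemma frag_extend_sum_mset:
  "frag_extend f (\<Sum>c\<in>#\<nu>. g c) = (\<Sum>c\<in>#\<nu>. frag_extend f (g c))"
  by (induction \<nu>) (simp_all add: frag_extend_add)

text \<open>Homomorphisms from a free abelian group are determined by their values on the
  generators. Every identity between products below is reduced in this way to one between single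
  multisets.\<close>

lemma frag_eqI_additive:
  assumes "\<And>p q. f (p - q) = f p - f q" "\<And>p q. g (p - q) = g p - g q"
    and "\<And>x. f (frag_of x) = g (frag_of x)"
  shows "f p = (g p :: 'b::ab_group_add)"
  using subset_UNIV
proof (induction p rule: frag_induction)
  case zero
  show ?case using assms(1)[of 0 0] assms(2)[of 0 0] by simp
qed (simp_all add: assms)

lemma keys_sum_mset:
  "Poly_Mapping.keys (\<Sum>c\<in>#\<nu>. g c) \<subseteq> (\<Union>c\<in>set_mset \<nu>. Poly_Mapping.keys (g c))"
  by (induction \<nu>) (use Poly_Mapping.keys_add in fastforce)+

text \<open>Integer combinations of multisets over \<open>'w\<close> form the polynomial ring over
  the integers with variables in \<open>'w\<close>; this is multiplication by the variable
  \<open>b\<close>.\<close>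

definition ins :: "'w \<Rightarrow> ('w multiset \<Rightarrow>\<^sub>0 int) \<Rightarrow> ('w multiset \<Rightarrow>\<^sub>0 int)"
  where "ins b = frag_extend (\<lambda>\<mu>. frag_of (add_mset b \<mu>))"

lemma ins_frag_of [simp]: "ins b (frag_of \<mu>) = frag_of (add_mset b \<mu>)"
  and ins_add: "ins b (p + q) = ins b p + ins b q"
  and ins_diff: "ins b (p - q) = ins b p - ins b q"
  and ins_0 [simp]: "ins b 0 = 0"
  and ins_sum_mset: "ins b (\<Sum>c\<in>#\<nu>. g c) = (\<Sum>c\<in>#\<nu>. ins b (g c))"
  by (simp_all add: ins_def frag_extend_add frag_extend_diff frag_extend_sum_mset)

lemma ins_commute: "ins a (ins b p) = ins b (ins a p)"
  by (rule frag_eqI_additive) (simp_all add: ins_diff add_mset_commute)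

lemma keys_ins: "Poly_Mapping.keys (ins b p) \<subseteq> add_mset b ` Poly_Mapping.keys p"
  unfolding ins_def using keys_frag_extend[of "\<lambda>\<mu>. frag_of (add_mset b \<mu>)" p] by auto

context semigroup
begin

text \<open>The element \<open>b\<close> is either left alone or multiplied into one of the factors \<open>c\<close> of \<open>\<nu>\<close>.\<close>

definition contract ::
    "'a \<Rightarrow> ('a multiset \<Rightarrow> 'a multiset \<Rightarrow>\<^sub>0 int) \<Rightarrow> 'a multiset \<Rightarrow> 'a multiset \<Rightarrow>\<^sub>0 int"
  where "contract b G \<nu> = ins b (G \<nu>) + (\<Sum>c\<in>#\<nu>. ins (b \<^bold>* c) (G (\<nu> - {#c#})))"

text \<open>The fold treats the elements of \<open>\<mu>\<close> one at a time in no specified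
  order; \<open>contract_commute\<close> makes it well defined.\<close>

definition nprod :: "'a multiset \<Rightarrow> 'a multiset \<Rightarrow> 'a multiset \<Rightarrow>\<^sub>0 int"
  where "nprod \<mu> = fold_mset contract frag_of \<mu>"

definition star :: "('a multiset \<Rightarrow>\<^sub>0 int) \<Rightarrow> ('a multiset \<Rightarrow>\<^sub>0 int) \<Rightarrow> 'a multiset \<Rightarrow>\<^sub>0 int"
  where "star p q = frag_extend (\<lambda>\<mu>. frag_extend (nprod \<mu>) q) p"

text \<open>Each of the two elements is left alone or joined to a factor of \<open>\<nu>\<close>,
  and if both are joined, then to different occurrences. The terms with at most one join match in
  pairs; those with two joins match by \<open>sum_mset_remove2_swap\<close>.\<close>

lemma contract_commute: "contract a (contract b G) = contract b (contract a G)"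
proof
  fix \<nu>
  have *: "contract u (contract v G) \<nu> =
      ins u (ins v (G \<nu>)) + ((\<Sum>c\<in>#\<nu>. ins u (ins (v \<^bold>* c) (G (\<nu> - {#c#}))))
      + (\<Sum>c\<in>#\<nu>. ins v (ins (u \<^bold>* c) (G (\<nu> - {#c#})))))
      + (\<Sum>c\<in>#\<nu>. \<Sum>d\<in>#\<nu> - {#c#}. ins (u \<^bold>* c) (ins (v \<^bold>* d) (G (\<nu> - {#c#} - {#d#}))))" for u v
    by (simp add: contract_def ins_add ins_sum_mset sum_mset.distrib ins_commute[of v] add.assoc)
  have "(\<Sum>c\<in>#\<nu>. \<Sum>d\<in>#\<nu> - {#c#}. ins (a \<^bold>* c) (ins (b \<^bold>* d) (G (\<nu> - {#c#} - {#d#}))))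
      = (\<Sum>c\<in>#\<nu>. \<Sum>d\<in>#\<nu> - {#c#}. ins (a \<^bold>* d) (ins (b \<^bold>* c) (G (\<nu> - {#c#} - {#d#}))))"
    by (rule sum_mset_remove2_swap[where g = "\<lambda>c d \<kappa>. ins (a \<^bold>* c) (ins (b \<^bold>* d) (G \<kappa>))"])
  also have "\<dots> = (\<Sum>c\<in>#\<nu>. \<Sum>d\<in>#\<nu> - {#c#}. ins (b \<^bold>* c) (ins (a \<^bold>* d) (G (\<nu> - {#c#} - {#d#}))))"
    by (simp only: ins_commute)
  finally show "contract a (contract b G) \<nu> = contract b (contract a G) \<nu>"
    unfolding * by (simp add: ins_commute[of a b] add.commute)
qed

lemma nprod_empty [simp]: "nprod {#} = frag_of"
  by (simp add: nprod_def)

lemma nprod_add_mset: "nprod (add_mset b \<mu>) = contract b (nprod \<mu>)"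
proof -
  interpret comp_fun_commute contract
    by standard (auto simp: contract_commute)
  show ?thesis by (simp add: nprod_def)
qed

lemma nprod_empty_right [simp]: "nprod \<mu> {#} = frag_of \<mu>"
  by (induction \<mu>) (simp_all add: nprod_add_mset contract_def)

lemma star_frag_of [simp]: "star (frag_of \<mu>) (frag_of \<nu>) = nprod \<mu> \<nu>"
  by (simp add: star_def)

text \<open>Linearity on the left is immediate from the outer extension. For the right argument the
  two linear extensions are first interchanged.\<close>

lemma star_diff_left: "star (p - q) r = star p r - star q r"
  and star_diff_right: "star p (q - r) = star p q - star p r"
proof -
  show "star (p - q) r = star p r - star q r"
    by (simp add: star_def frag_extend_diff)
  have *: "star s r = frag_extend (\<lambda>\<nu>. frag_extend (\<lambda>\<mu>. nprod \<mu> \<nu>) s) r" for s r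
    unfolding star_def
    by (rule frag_eqI_additive[of _ _ s])
      (auto simp: frag_extend_diff intro: frag_eqI_additive[of _ _ r])
  show "star p (q - r) = star p q - star p r"
    unfolding * by (simp add: frag_extend_diff)
qed

lemma star_0 [simp]: "star 0 p = 0" "star p 0 = 0"
  using star_diff_left[of 0 0 p] star_diff_right[of p 0 0] by simp_all

lemma star_add_left: "star (p + q) r = star p r + star q r"
  by (simp add: star_def frag_extend_add)

lemma star_sum_mset_left: "star (\<Sum>c\<in>#\<nu>. g c) r = (\<Sum>c\<in>#\<nu>. star (g c) r)"
  by (induction \<nu>) (simp_all add: star_add_left)

lemma nprod_single:
  "nprod {#b#} \<nu> = frag_of (add_mset b \<nu>) + (\<Sum>c\<in>#\<nu>. frag_of (add_mset (b \<^bold>* c) (\<nu> - {#c#})))"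
  by (simp add: nprod_add_mset contract_def)

text \<open>Left multiplication by a singleton is multiplication by the variable \<open>b\<close>
  plus a derivation of the polynomial ring, which sends \<open>a\<close> to the product of
  \<open>b\<close> and \<open>a\<close>. This is its commutator with multiplication by
  \<open>a\<close>.\<close>

lemma star_single_ins:
  "star (frag_of {#b#}) (ins a p) = ins a (star (frag_of {#b#}) p) + ins (b \<^bold>* a) p"
proof (rule frag_eqI_additive[of _ _ p])
  fix \<nu>
  show "star (frag_of {#b#}) (ins a (frag_of \<nu>))
      = ins a (star (frag_of {#b#}) (frag_of \<nu>)) + ins (b \<^bold>* a) (frag_of \<nu>)"
    by (simp only: ins_frag_of star_frag_of nprod_single ins_add ins_sum_mset
        sum_mset_remove1_add_mset[where h = "\<lambda>c \<kappa>. frag_of (add_mset (b \<^bold>* c) \<kappa>)"])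
      (simp add: add_mset_commute ac_simps)
qed (simp_all add: star_diff_right ins_diff)

lemma contract_add: "contract a (\<lambda>\<nu>. G \<nu> + H \<nu>) \<nu> = contract a G \<nu> + contract a H \<nu>"
  by (simp add: contract_def ins_add sum_mset.distrib ac_simps)

lemma contract_sum_mset: "contract a (\<lambda>\<nu>. \<Sum>c\<in>#\<mu>. G c \<nu>) \<nu> = (\<Sum>c\<in>#\<mu>. contract a (G c) \<nu>)"
proof (induction \<mu>)
  case empty
  then show ?case by (simp add: contract_def)
next
  case (add x \<mu>)
  then show ?case by (simp add: contract_add)
qed

text \<open>This is associativity for a singleton, \<open>\<mu>\<close> and \<open>\<nu>\<close>,
  with the product of the singleton and \<open>\<mu>\<close> written out. Adding \<open>a\<close> to
  \<open>\<mu>\<close> uses the commutator rule \<open>star_single_ins\<close>; associativity of the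
  semigroup identifies the two ways to merge \<open>b\<close>, \<open>a\<close> and a factor of
  \<open>\<nu>\<close>.\<close>

lemma star_single_nprod:
  "star (frag_of {#b#}) (nprod \<mu> \<nu>)
    = nprod (add_mset b \<mu>) \<nu> + (\<Sum>c\<in>#\<mu>. nprod (add_mset (b \<^bold>* c) (\<mu> - {#c#})) \<nu>)"
proof (induction \<mu> arbitrary: \<nu>)
  case empty
  then show ?case by simp
next
  case (add a \<mu>)
  have star_add_right: "star r (p + q) = star r p + star r q" for r p q
    using star_diff_right[of r p "0 - q"] star_diff_right[of r 0 q] by simp
  have star_sum_right: "star r (\<Sum>c\<in>#\<nu>. g c) = (\<Sum>c\<in>#\<nu>. star r (g c))" for r \<nu> g
    by (induction \<nu>) (simp_all add: star_add_right)
  have "star (frag_of {#b#}) (nprod (add_mset a \<mu>) \<nu>)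
      = contract a (\<lambda>\<nu>. star (frag_of {#b#}) (nprod \<mu> \<nu>)) \<nu> + contract (b \<^bold>* a) (nprod \<mu>) \<nu>"
    by (simp add: nprod_add_mset contract_def star_add_right star_sum_right star_single_ins
        sum_mset.distrib assoc ac_simps)
  also have "\<dots> = nprod (add_mset b (add_mset a \<mu>)) \<nu>
      + (\<Sum>c\<in>#\<mu>. nprod (add_mset (b \<^bold>* c) (add_mset a (\<mu> - {#c#}))) \<nu>)
      + nprod (add_mset (b \<^bold>* a) \<mu>) \<nu>"
    unfolding add.IH by (simp add: contract_add contract_sum_mset nprod_add_mset contract_commute[of a])
  also have "\<dots> = nprod (add_mset b (add_mset a \<mu>)) \<nu>
      + (\<Sum>c\<in>#add_mset a \<mu>. nprod (add_mset (b \<^bold>* c) (add_mset a \<mu> - {#c#})) \<nu>)"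
    by (simp only: sum_mset_remove1_add_mset[where h = "\<lambda>c \<kappa>. nprod (add_mset (b \<^bold>* c) \<kappa>) \<nu>"])
      (simp add: ac_simps)
  finally show ?case .
qed

lemma star_single_assoc: "star (star (frag_of {#b#}) p) q = star (frag_of {#b#}) (star p q)"
proof (rule frag_eqI_additive[of _ _ p])
  fix \<mu>
  show "star (star (frag_of {#b#}) (frag_of \<mu>)) q = star (frag_of {#b#}) (star (frag_of \<mu>) q)"
  proof (rule frag_eqI_additive[of _ _ q])
    fix \<nu>
    show "star (star (frag_of {#b#}) (frag_of \<mu>)) (frag_of \<nu>)
        = star (frag_of {#b#}) (star (frag_of \<mu>) (frag_of \<nu>))"
      by (simp add: star_single_nprod nprod_single[of b \<mu>] star_add_left star_sum_mset_left)
  qed (simp_all add: star_diff_right)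
qed (simp_all add: star_diff_left star_diff_right)

text \<open>A left factor that is a singleton is settled by \<open>star_single_assoc\<close>. The
  general case follows by induction on the size of the left factor, because singletons generate
  everything up to terms of smaller size.\<close>

theorem star_assoc: "star (star p q) r = star p (star q r)"
proof (rule frag_eqI_additive[of _ _ p])
  fix \<mu>
  show "star (star (frag_of \<mu>) q) r = star (frag_of \<mu>) (star q r)"
  proof (induction "size \<mu>" arbitrary: \<mu> q r rule: less_induct)
    case less
    show ?case
    proof (cases \<mu>)
      case empty
      have "star (frag_of {#}) s = s" for s
        by (rule frag_eqI_additive[of _ _ s]) (simp_all add: star_diff_right del: single_one)
      then show ?thesis using empty by simp
    next
      case (add b \<mu>')
      define rest where "rest = (\<Sum>c\<in>#\<mu>'. frag_of (add_mset (b \<^bold>* c) (\<mu>' - {#c#})))"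
      \<comment> \<open>The expansion of the singleton times \<open>\<mu>'\<close> is solved for its
        top term. Every multiset in \<open>rest\<close> has the size of \<open>\<mu>'\<close>, so
        the induction hypothesis applies to \<open>rest\<close> and to
        \<open>\<mu>'\<close>.\<close>
      have \<mu>: "frag_of \<mu> = star (frag_of {#b#}) (frag_of \<mu>') - rest"
        by (simp add: add rest_def nprod_single)
      have IH: "star (star (frag_of \<kappa>) q) r = star (frag_of \<kappa>) (star q r)"
        if "size \<kappa> < size \<mu>" for \<kappa> q r
        using less that by blast
      have "star (star rest q) r = star rest (star q r)"
        unfolding rest_def star_sum_mset_left
      proof (intro arg_cong[of _ _ sum_mset] image_mset_cong IH)
        fix c assume "c \<in># \<mu>'"
        then have "Suc (size (\<mu>' - {#c#})) = size \<mu>'"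
          by (rule size_Suc_Diff1)
        then show "size (add_mset (b \<^bold>* c) (\<mu>' - {#c#})) < size \<mu>"
          by (simp only: add size_add_mset lessI)
      qed
      then show ?thesis
        unfolding \<mu> by (simp add: star_diff_left star_single_assoc IH add del: star_frag_of)
    qed
  qed
qed (simp_all add: star_diff_left)

section \<open>The terms of a product: support, size, weight and top term\<close>

lemma keys_nprod_add_mset:
  "Poly_Mapping.keys (nprod (add_mset b \<mu>) \<nu>) \<subseteq> add_mset b ` Poly_Mapping.keys (nprod \<mu> \<nu>)
    \<union> (\<Union>c\<in>set_mset \<nu>. add_mset (b \<^bold>* c) ` Poly_Mapping.keys (nprod \<mu> (\<nu> - {#c#})))"
proof -
  have "Poly_Mapping.keys (\<Sum>c\<in>#\<nu>. ins (b \<^bold>* c) (nprod \<mu> (\<nu> - {#c#})))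
      \<subseteq> (\<Union>c\<in>set_mset \<nu>. add_mset (b \<^bold>* c) ` Poly_Mapping.keys (nprod \<mu> (\<nu> - {#c#})))"
    by (rule order_trans[OF keys_sum_mset]) (rule UN_mono[OF order_refl keys_ins])
  with keys_ins[of b "nprod \<mu> \<nu>"] show ?thesis
    unfolding nprod_add_mset contract_def
    by (intro order_trans[OF Poly_Mapping.keys_add]) blast
qed

text \<open>The multisets in a product come from partial matchings between the factors: each element
  of \<open>\<mu>\<close> is kept or merged with its own occurrence in \<open>\<nu>\<close>, and
  what remains of \<open>\<nu>\<close> is kept. The three cases build such a matching, so properties
  of terms need no further look at coefficients.\<close>

lemma nprod_keys_induct [consumes 1, case_names empty keep join]:
  assumes "\<kappa> \<in> Poly_Mapping.keys (nprod \<mu> \<nu>)"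
    and empty: "\<And>\<nu>. P {#} \<nu> \<nu>"
    and keep: "\<And>b \<mu> \<nu> \<kappa>. P \<mu> \<nu> \<kappa> \<Longrightarrow> P (add_mset b \<mu>) \<nu> (add_mset b \<kappa>)"
    and join: "\<And>b c \<mu> \<nu> \<kappa>. P \<mu> \<nu> \<kappa> \<Longrightarrow> P (add_mset b \<mu>) (add_mset c \<nu>) (add_mset (b \<^bold>* c) \<kappa>)"
  shows "P \<mu> \<nu> \<kappa>"
  using assms(1)
proof (induction \<mu> arbitrary: \<nu> \<kappa>)
  case empty
  then show ?case using assms(2) by (simp split: if_splits)
next
  case (add b \<mu>)
  then consider \<kappa>' where "\<kappa>' \<in> Poly_Mapping.keys (nprod \<mu> \<nu>)" "\<kappa> = add_mset b \<kappa>'"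
    | c \<kappa>' where "c \<in># \<nu>" "\<kappa>' \<in> Poly_Mapping.keys (nprod \<mu> (\<nu> - {#c#}))" "\<kappa> = add_mset (b \<^bold>* c) \<kappa>'"
    using keys_nprod_add_mset by blast
  then show ?case
  proof cases
    case 1
    then show ?thesis using add.IH keep by blast
  next
    case 2
    then show ?thesis using add.IH join[of \<mu> "\<nu> - {#c#}" \<kappa>' b c] by simp
  qed
qed

lemma size_le_of_keys_nprod:
  "\<kappa> \<in> Poly_Mapping.keys (nprod \<mu> \<nu>) \<Longrightarrow> size \<kappa> \<le> size \<mu> + size \<nu> \<and> size \<mu> \<le> size \<kappa>"
  by (induction rule: nprod_keys_induct) auto

lemma set_mset_of_keys_nprod:
  assumes "\<And>b c. b \<in> W \<Longrightarrow> c \<in> W \<Longrightarrow> b \<^bold>* c \<in> W"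
  shows "\<kappa> \<in> Poly_Mapping.keys (nprod \<mu> \<nu>) \<Longrightarrow> set_mset \<mu> \<subseteq> W \<longrightarrow> set_mset \<nu> \<subseteq> W \<longrightarrow> set_mset \<kappa> \<subseteq> W"
  by (induction rule: nprod_keys_induct) (use assms in auto)

lemma weight_of_keys_nprod:
  fixes l :: "'a \<Rightarrow> nat"
  assumes "\<And>b c. l (b \<^bold>* c) = l b + l c"
  shows "\<kappa> \<in> Poly_Mapping.keys (nprod \<mu> \<nu>) \<Longrightarrow> (\<Sum>w\<in>#\<kappa>. l w) = (\<Sum>w\<in>#\<mu>. l w) + (\<Sum>w\<in>#\<nu>. l w)"
  by (induction rule: nprod_keys_induct) (simp_all add: assms)

text \<open>Each merge reduces the size by one, so only the empty matching reaches the full size.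
  Hence the associated graded product is that of polynomials.\<close>

lemma nprod_top:
  "\<exists>r. nprod \<mu> \<nu> = frag_of (\<mu> + \<nu>) + r \<and> (\<forall>\<kappa>\<in>Poly_Mapping.keys r. size \<kappa> < size \<mu> + size \<nu>)"
proof (induction \<mu>)
  case empty
  show ?case by (rule exI[of _ 0]) simp
next
  case (add b \<mu>)
  then obtain r where r: "nprod \<mu> \<nu> = frag_of (\<mu> + \<nu>) + r"
      "\<And>\<kappa>. \<kappa> \<in> Poly_Mapping.keys r \<Longrightarrow> size \<kappa> < size \<mu> + size \<nu>"
    by blast
  define s where "s = (\<Sum>c\<in>#\<nu>. ins (b \<^bold>* c) (nprod \<mu> (\<nu> - {#c#})))"
  have "size \<kappa> < Suc (size \<mu> + size \<nu>)" if \<kappa>: "\<kappa> \<in> Poly_Mapping.keys s" for \<kappa>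
  proof -
    obtain c where c: "c \<in># \<nu>"
        "\<kappa> \<in> Poly_Mapping.keys (ins (b \<^bold>* c) (nprod \<mu> (\<nu> - {#c#})))"
      using subsetD[OF keys_sum_mset \<kappa>[unfolded s_def]] by blast
    obtain \<kappa>' where "\<kappa>' \<in> Poly_Mapping.keys (nprod \<mu> (\<nu> - {#c#}))"
        "\<kappa> = add_mset (b \<^bold>* c) \<kappa>'"
      using subsetD[OF keys_ins c(2)] by blast
    then show ?thesis
      using size_le_of_keys_nprod[of \<kappa>' \<mu> "\<nu> - {#c#}"] size_Suc_Diff1[OF c(1)]
      by simp
  qed
  moreover have "size \<kappa> < Suc (size \<mu> + size \<nu>)" if \<kappa>: "\<kappa> \<in> Poly_Mapping.keys (ins b r)" for \<kappa>
  proof -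
    obtain \<kappa>' where "\<kappa>' \<in> Poly_Mapping.keys r" "\<kappa> = add_mset b \<kappa>'"
      using subsetD[OF keys_ins \<kappa>] by blast
    then show ?thesis using r(2) by fastforce
  qed
  ultimately have "size \<kappa> < Suc (size \<mu> + size \<nu>)" if "\<kappa> \<in> Poly_Mapping.keys (ins b r + s)" for \<kappa>
    using that Poly_Mapping.keys_add[of "ins b r" s] by blast
  then show ?case
    by (intro exI[of _ "ins b r + s"])
      (simp add: nprod_add_mset contract_def r(1) ins_add s_def add.assoc)
qed

text \<open>Since the coefficient is the integer 1, the top term survives in every
  characteristic.\<close>

lemma lookup_nprod_top: "Poly_Mapping.lookup (nprod \<mu> \<nu>) (\<mu> + \<nu>) = 1"
proof -
  obtain r where r: "nprod \<mu> \<nu> = frag_of (\<mu> + \<nu>) + r"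
      "\<And>\<kappa>. \<kappa> \<in> Poly_Mapping.keys r \<Longrightarrow> size \<kappa> < size \<mu> + size \<nu>"
    using nprod_top by blast
  then have "\<mu> + \<nu> \<notin> Poly_Mapping.keys r" by fastforce
  then show ?thesis by (simp add: r(1) lookup_add in_keys_iff)
qed

lemma keys_nprod_top:
  assumes "\<kappa> \<in> Poly_Mapping.keys (nprod \<mu> \<nu>)" "size \<kappa> = size \<mu> + size \<nu>"
  shows "\<kappa> = \<mu> + \<nu>"
proof -
  obtain r where r: "nprod \<mu> \<nu> = frag_of (\<mu> + \<nu>) + r"
      "\<And>\<kappa>. \<kappa> \<in> Poly_Mapping.keys r \<Longrightarrow> size \<kappa> < size \<mu> + size \<nu>"
    using nprod_top by blast
  then show ?thesis
    using assms Poly_Mapping.keys_add[of "frag_of (\<mu> + \<nu>)" r]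
    unfolding keys_frag_of r(1) by fastforce
qed

text \<open>A term has at least the size of the left factor, so a left factor of size two or more
  contributes no singleton. This is the projection onto multisets of size one, where the product is
  that of the semigroup.\<close>

lemma lookup_nprod_single_single:
  "Poly_Mapping.lookup (nprod \<mu> {#b#}) {#v#} = (if \<mu> = {#} \<and> b = v \<or> (\<exists>a. \<mu> = {#a#} \<and> a \<^bold>* b = v) then 1 else 0)"
proof (cases "size \<mu> \<le> 1")
  case True
  then consider "\<mu> = {#}" | a where "\<mu> = {#a#}"
    by (metis One_nat_def le_Suc_eq le_zero_eq size_eq_0_iff_empty size_1_singleton_mset)
  then show ?thesis
    by cases (auto simp: nprod_single lookup_add)
next
  case False
  then have "{#v#} \<notin> Poly_Mapping.keys (nprod \<mu> {#b#})"
    using size_le_of_keys_nprod[of "{#v#}" \<mu> "{#b#}"] by auto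
  then show ?thesis using False by (auto simp: in_keys_iff)
qed

end

text \<open>Take in each set a multiset of largest size, and among those the largest in the multiset
  order. A product containing \<open>\<mu> + \<nu>\<close> must have factors of the same maximal
  sizes, so \<open>\<mu> + \<nu>\<close> is its top term, the sum of its factors. Strict
  monotonicity of addition in the multiset order then determines both factors.\<close>

lemma nprod_unique_product:
  fixes f :: "'w::linorder \<Rightarrow> 'w \<Rightarrow> 'w"
  assumes "semigroup f" "finite A" "A \<noteq> {}" "finite B" "B \<noteq> {}"
  obtains \<mu> \<nu> where "\<mu> \<in> A" "\<nu> \<in> B"
    "\<And>\<mu>' \<nu>'. \<mu>' \<in> A \<Longrightarrow> \<nu>' \<in> B \<Longrightarrow> \<mu> + \<nu> \<in> Poly_Mapping.keys (semigroup.nprod f \<mu>' \<nu>')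
      \<Longrightarrow> \<mu>' = \<mu> \<and> \<nu>' = \<nu>"
proof -
  interpret semigroup f by fact
  have leading: "\<exists>\<mu>\<in>C. \<forall>\<mu>'\<in>C. size \<mu>' < size \<mu> \<or> size \<mu>' = size \<mu> \<and> \<mu>' \<le> \<mu>"
    if C: "finite C" "C \<noteq> {}" for C :: "'w multiset set"
  proof -
    define D where "D = {\<mu>\<in>C. size \<mu> = Max (size ` C)}"
    have "Max (size ` C) \<in> size ` C" using C by simp
    then have "finite D" "D \<noteq> {}" using C unfolding D_def by (simp, fastforce)
    then have "Max D \<in> D" and le: "\<And>\<mu>. \<mu> \<in> D \<Longrightarrow> \<mu> \<le> Max D" by auto
    then have D: "Max D \<in> C" "size (Max D) = Max (size ` C)" by (simp_all add: D_def)
    show ?thesis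
    proof (intro bexI[of _ "Max D"] ballI)
      fix \<mu>' assume "\<mu>' \<in> C"
      then have "size \<mu>' \<le> Max (size ` C)" using C by simp
      then show "size \<mu>' < size (Max D) \<or> size \<mu>' = size (Max D) \<and> \<mu>' \<le> Max D"
        using D(2) le[of \<mu>'] \<open>\<mu>' \<in> C\<close> by (auto simp: D_def)
    qed (rule D(1))
  qed
  obtain \<mu> where \<mu>: "\<mu> \<in> A" "\<And>\<mu>'. \<mu>' \<in> A \<Longrightarrow> size \<mu>' < size \<mu> \<or> size \<mu>' = size \<mu> \<and> \<mu>' \<le> \<mu>"
    using leading[OF assms(2,3)] by blast
  obtain \<nu> where \<nu>: "\<nu> \<in> B" "\<And>\<nu>'. \<nu>' \<in> B \<Longrightarrow> size \<nu>' < size \<nu> \<or> size \<nu>' = size \<nu> \<and> \<nu>' \<le> \<nu>"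
    using leading[OF assms(4,5)] by blast
  show thesis
  proof (rule that[OF \<mu>(1) \<nu>(1)])
    fix \<mu>' \<nu>' assume *: "\<mu>' \<in> A" "\<nu>' \<in> B" "\<mu> + \<nu> \<in> Poly_Mapping.keys (nprod \<mu>' \<nu>')"
    have "size (\<mu> + \<nu>) \<le> size \<mu>' + size \<nu>'"
      using size_le_of_keys_nprod[OF *(3)] by simp
    then have eq: "size \<mu>' = size \<mu>" "size \<nu>' = size \<nu>" and le: "\<mu>' \<le> \<mu>" "\<nu>' \<le> \<nu>"
      using \<mu>(2)[OF *(1)] \<nu>(2)[OF *(2)] by auto
    have "\<mu> + \<nu> = \<mu>' + \<nu>'"
      using keys_nprod_top[OF *(3)] eq by simp
    then show "\<mu>' = \<mu> \<and> \<nu>' = \<nu>"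
      using le add_less_le_mono[of \<mu>' \<mu> \<nu>' \<nu>] add_le_less_mono[of \<mu>' \<mu> \<nu>' \<nu>]
      by (auto simp: order_le_less)
  qed
qed

section \<open>Algebras from graded structure constants\<close>


context abelian_monoid
begin

lemma finsum_swap:
  assumes "finite A" "finite B" "\<And>i j. i \<in> A \<Longrightarrow> j \<in> B \<Longrightarrow> f i j \<in> carrier G"
  shows "(\<Oplus>i\<in>A. \<Oplus>j\<in>B. f i j) = (\<Oplus>j\<in>B. \<Oplus>i\<in>A. f i j)"
  using assms(1,3)
proof (induction A rule: finite_induct)
  case empty
  then show ?case by simp
next
  case (insert x A)
  then have "(\<Oplus>i\<in>insert x A. \<Oplus>j\<in>B. f i j) = (\<Oplus>j\<in>B. f x j) \<oplus> (\<Oplus>j\<in>B. \<Oplus>i\<in>A. f i j)"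
    by (subst finsum_insert) auto
  also have "\<dots> = (\<Oplus>j\<in>B. f x j \<oplus> (\<Oplus>i\<in>A. f i j))"
    using insert by (subst finsum_addf) auto
  also have "\<dots> = (\<Oplus>j\<in>B. \<Oplus>i\<in>insert x A. f i j)"
    using insert by (intro finsum_cong') (auto intro!: finsum_insert[symmetric])
  finally show ?case .
qed

end

text \<open>The number \<open>c i j k\<close> is the coefficient of the basis element
  \<open>k\<close> in the product of \<open>i\<close> and \<open>j\<close>; integer values serve all
  fields at once. The sums in \<open>c_assoc\<close> are cut off at the weight of \<open>n\<close>
  to make them finite: by \<open>weight_add\<close> the omitted terms vanish. The condition
  \<open>unique_product\<close> replaces a leading term argument.\<close>

locale graded_structure_constants = field F for F :: "('f, 'm) ring_scheme" (structure) +
  fixes I :: "'i set" and c :: "'i \<Rightarrow> 'i \<Rightarrow> 'i \<Rightarrow> int" and e :: 'i and wt :: "'i \<Rightarrow> nat"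
  assumes finite_weight_le: "finite {i\<in>I. wt i \<le> N}"
    and unit_in: "e \<in> I"
    and unit_left: "\<lbrakk>j \<in> I; k \<in> I\<rbrakk> \<Longrightarrow> c e j k = (if j = k then 1 else 0)"
    and unit_right: "\<lbrakk>j \<in> I; k \<in> I\<rbrakk> \<Longrightarrow> c j e k = (if j = k then 1 else 0)"
    and weight_add: "\<lbrakk>i \<in> I; j \<in> I; k \<in> I; c i j k \<noteq> 0\<rbrakk> \<Longrightarrow> wt k = wt i + wt j"
    and c_assoc: "\<lbrakk>i \<in> I; j \<in> I; l \<in> I; n \<in> I\<rbrakk> \<Longrightarrow>
      (\<Sum>k | k \<in> I \<and> wt k \<le> wt n. c i j k * c k l n) = (\<Sum>k | k \<in> I \<and> wt k \<le> wt n. c j l k * c i k n)"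
    and unique_product: "\<lbrakk>finite A; A \<subseteq> I; A \<noteq> {}; finite B; B \<subseteq> I; B \<noteq> {}\<rbrakk> \<Longrightarrow>
      \<exists>i\<in>A. \<exists>j\<in>B. \<exists>k\<in>I. c i j k = 1 \<and> (\<forall>i'\<in>A. \<forall>j'\<in>B. c i' j' k \<noteq> 0 \<longrightarrow> i' = i \<and> j' = j)"
begin

definition below :: "nat \<Rightarrow> 'i set"
  where "below n = {i\<in>I. wt i \<le> n}"

definition emb :: "int \<Rightarrow> 'f"
  where "emb n = [n] \<cdot> \<one>"

definition prodf :: "('i \<Rightarrow> 'f) \<Rightarrow> ('i \<Rightarrow> 'f) \<Rightarrow> 'i \<Rightarrow> 'f"
  where "prodf a b k = (if k \<in> I
    then \<Oplus>i\<in>below (wt k). \<Oplus>j\<in>below (wt k). emb (c i j k) \<otimes> (a i \<otimes> b j) else \<zero>)"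

text \<open>There is no condition of finite support: this is the completion, analogous to power
  series. Its product makes sense because by \<open>weight_add\<close> only the finitely many pairs
  of weight at most \<open>wt k\<close> contribute to the coefficient at \<open>k\<close>.\<close>

definition salg :: "('f, 'i \<Rightarrow> 'f) module"
  where "salg = \<lparr>carrier = {a. (\<forall>i. a i \<in> carrier F) \<and> (\<forall>i. i \<notin> I \<longrightarrow> a i = \<zero>)},
    monoid.mult = prodf, one = (\<lambda>i. if i = e then \<one> else \<zero>), zero = (\<lambda>_. \<zero>),
    add = (\<lambda>a b i. a i \<oplus> b i), smult = (\<lambda>k a i. k \<otimes> a i)\<rparr>"

lemma finite_below [simp]: "finite (below n)"
  using finite_weight_le by (simp add: below_def)

lemma emb_closed [simp]: "emb n \<in> carrier F"
  by (simp add: emb_def)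

lemma emb_0 [simp]: "emb 0 = \<zero>"
  and emb_1 [simp]: "emb 1 = \<one>"
  and emb_add: "emb (m + n) = emb m \<oplus> emb n"
proof -
  show "emb 0 = \<zero>" "emb 1 = \<one>"
    by (simp_all add: emb_def add_pow_def int_pow_def2)
  show "emb (m + n) = emb m \<oplus> emb n"
    unfolding emb_def by (rule add.int_pow_mult) simp
qed

lemma emb_mult: "emb (m * n) = emb m \<otimes> emb n"
proof -
  have "emb m \<otimes> emb n = [m] \<cdot> (\<one> \<otimes> ([n] \<cdot> \<one>))"
    unfolding emb_def by (rule add_pow_ldistr_int) simp_all
  also have "\<dots> = [(n * m)] \<cdot> \<one>"
    by (simp add: add.int_pow_pow)
  finally show ?thesis by (simp only: emb_def mult.commute)
qed

lemma emb_sum: "finite A \<Longrightarrow> emb (\<Sum>i\<in>A. g i) = (\<Oplus>i\<in>A. emb (g i))"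
  by (induction A rule: finite_induct) (simp_all add: emb_add)

lemma salg_sel [simp]:
  "monoid.mult salg = prodf" "one salg = (\<lambda>i. if i = e then \<one> else \<zero>)" "zero salg = (\<lambda>_. \<zero>)"
  "add salg = (\<lambda>a b i. a i \<oplus> b i)" "smult salg = (\<lambda>k a i. k \<otimes> a i)"
  by (simp_all add: salg_def)

lemma mem_salg: "a \<in> carrier salg \<longleftrightarrow> (\<forall>i. a i \<in> carrier F) \<and> (\<forall>i. i \<notin> I \<longrightarrow> a i = \<zero>)"
  by (simp add: salg_def)

lemma salg_closed [simp]: "a \<in> carrier salg \<Longrightarrow> a i \<in> carrier F"
  by (simp add: mem_salg)

lemma c_below: "\<lbrakk>i \<in> I; j \<in> I; k \<in> I; wt k \<le> N; i \<notin> below (wt k) \<or> j \<notin> below (wt k)\<rbrakk> \<Longrightarrow> c i j k = 0"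
  using weight_add[of i j k] by (cases "c i j k = 0") (auto simp: below_def)

text \<open>The cutoff \<open>wt k\<close> may be raised to any common bound. With a bound that does
  not depend on the summation variables, nested sums can be interchanged.\<close>

lemma prodf_eq:
  assumes ab: "a \<in> carrier salg" "b \<in> carrier salg" and k: "k \<in> below N"
  shows "prodf a b k = (\<Oplus>i\<in>below N. \<Oplus>j\<in>below N. emb (c i j k) \<otimes> (a i \<otimes> b j))"
proof -
  have sub: "below (wt k) \<subseteq> below N" and kI: "k \<in> I" and kN: "wt k \<le> N"
    using k by (auto simp: below_def)
  have c0: "emb (c i j k) \<otimes> (a i \<otimes> b j) = \<zero>"
    if "i \<in> below N" "j \<in> below N" "i \<notin> below (wt k) \<or> j \<notin> below (wt k)" for i j
    using c_below[of i j k N] that kI kN ab by (auto simp: below_def)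
  have "prodf a b k = (\<Oplus>i\<in>below (wt k). \<Oplus>j\<in>below N. emb (c i j k) \<otimes> (a i \<otimes> b j))"
  proof -
    have "prodf a b k = (\<Oplus>i\<in>below (wt k). \<Oplus>j\<in>below (wt k). emb (c i j k) \<otimes> (a i \<otimes> b j))"
      using kI by (simp add: prodf_def)
    also have "\<dots> = (\<Oplus>i\<in>below (wt k). \<Oplus>j\<in>below N. emb (c i j k) \<otimes> (a i \<otimes> b j))"
    proof (rule finsum_cong'[OF refl])
      fix i assume "i \<in> below (wt k)"
      then have "i \<in> below N" using sub by blast
      then show "(\<Oplus>j\<in>below (wt k). emb (c i j k) \<otimes> (a i \<otimes> b j))
          = (\<Oplus>j\<in>below N. emb (c i j k) \<otimes> (a i \<otimes> b j))"
        using ab sub by (intro add.finprod_mono_neutral_cong_left c0) auto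
    qed (use ab in auto)
    finally show ?thesis .
  qed
  also have "\<dots> = (\<Oplus>i\<in>below N. \<Oplus>j\<in>below N. emb (c i j k) \<otimes> (a i \<otimes> b j))"
    using ab sub by (intro add.finprod_mono_neutral_cong_left) (auto intro!: add.finprod_one_eqI c0)
  finally show ?thesis .
qed

lemma prodf_closed [simp]:
  assumes "a \<in> carrier salg" "b \<in> carrier salg"
  shows "prodf a b \<in> carrier salg"
  using assms by (auto simp: mem_salg prodf_def intro!: finsum_closed)

lemma finsum_below4:
  assumes "\<And>k l i j. f k l i j \<in> carrier F"
  shows "(\<Oplus>k\<in>below N. \<Oplus>l\<in>below N. \<Oplus>i\<in>below N. \<Oplus>j\<in>below N. f k l i j)
    = (\<Oplus>i\<in>below N. \<Oplus>j\<in>below N. \<Oplus>l\<in>below N. \<Oplus>k\<in>below N. f k l i j)"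
proof -
  have "(\<Oplus>k\<in>below N. \<Oplus>l\<in>below N. \<Oplus>i\<in>below N. \<Oplus>j\<in>below N. f k l i j)
      = (\<Oplus>k\<in>below N. \<Oplus>i\<in>below N. \<Oplus>l\<in>below N. \<Oplus>j\<in>below N. f k l i j)"
    using assms by (intro finsum_cong' refl finsum_swap) (auto intro!: finsum_closed)
  also have "\<dots> = (\<Oplus>i\<in>below N. \<Oplus>k\<in>below N. \<Oplus>l\<in>below N. \<Oplus>j\<in>below N. f k l i j)"
    using assms by (intro finsum_swap) (auto intro!: finsum_closed)
  also have "\<dots> = (\<Oplus>i\<in>below N. \<Oplus>k\<in>below N. \<Oplus>j\<in>below N. \<Oplus>l\<in>below N. f k l i j)"
    using assms by (intro finsum_cong' refl finsum_swap) (auto intro!: finsum_closed)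
  also have "\<dots> = (\<Oplus>i\<in>below N. \<Oplus>j\<in>below N. \<Oplus>k\<in>below N. \<Oplus>l\<in>below N. f k l i j)"
    using assms by (intro finsum_cong' refl finsum_swap) (auto intro!: finsum_closed)
  also have "\<dots> = (\<Oplus>i\<in>below N. \<Oplus>j\<in>below N. \<Oplus>l\<in>below N. \<Oplus>k\<in>below N. f k l i j)"
    using assms by (intro finsum_cong' refl finsum_swap) (auto intro!: finsum_closed)
  finally show ?thesis .
qed

text \<open>At a fixed coefficient \<open>n\<close> all sums run up to the weight of
  \<open>n\<close>. Both sides become sums over \<open>i\<close>, \<open>j\<close>, \<open>l\<close>
  of an integer times the product of three coefficients, and \<open>c_assoc\<close> equates the
  integers.\<close>

lemma prodf_assoc:
  assumes abd: "a \<in> carrier salg" "b \<in> carrier salg" "d \<in> carrier salg"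
  shows "prodf (prodf a b) d = prodf a (prodf b d)"
proof
  fix n
  show "prodf (prodf a b) d n = prodf a (prodf b d) n"
  proof (cases "n \<in> I")
    case False
    then show ?thesis by (simp add: prodf_def)
  next
    case True
    define N where "N = wt n"
    have n: "n \<in> below N" using True by (simp add: below_def N_def)
    define p where "p i j l = a i \<otimes> b j \<otimes> d l" for i j l
    have p: "p i j l \<in> carrier F" for i j l using abd by (simp add: p_def)
    have "prodf (prodf a b) d n = (\<Oplus>k\<in>below N. \<Oplus>l\<in>below N. emb (c k l n) \<otimes> (prodf a b k \<otimes> d l))"
      using abd n by (intro prodf_eq) auto
    also have "\<dots> = (\<Oplus>k\<in>below N. \<Oplus>l\<in>below N. emb (c k l n) \<otimes>
        ((\<Oplus>i\<in>below N. \<Oplus>j\<in>below N. emb (c i j k) \<otimes> (a i \<otimes> b j)) \<otimes> d l))"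
      using abd by (intro finsum_cong' refl) (auto simp: prodf_eq[symmetric] intro!: finsum_closed)
    also have "\<dots> = (\<Oplus>k\<in>below N. \<Oplus>l\<in>below N. \<Oplus>i\<in>below N. \<Oplus>j\<in>below N.
        emb (c k l n) \<otimes> (emb (c i j k) \<otimes> (a i \<otimes> b j) \<otimes> d l))"
      using abd by (intro finsum_cong' refl) (auto simp: finsum_ldistr finsum_rdistr Pi_def)
    also have "\<dots> = (\<Oplus>k\<in>below N. \<Oplus>l\<in>below N. \<Oplus>i\<in>below N. \<Oplus>j\<in>below N.
        emb (c i j k * c k l n) \<otimes> p i j l)"
      using abd by (intro finsum_cong' refl) (auto simp: emb_mult p_def m_ac intro!: finsum_closed)
    also have "\<dots> = (\<Oplus>i\<in>below N. \<Oplus>j\<in>below N. \<Oplus>l\<in>below N. \<Oplus>k\<in>below N.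
        emb (c i j k * c k l n) \<otimes> p i j l)"
      using p by (intro finsum_below4) auto
    also have "\<dots> = (\<Oplus>i\<in>below N. \<Oplus>j\<in>below N. \<Oplus>l\<in>below N.
        emb (\<Sum>k\<in>below N. c i j k * c k l n) \<otimes> p i j l)"
      using p by (intro finsum_cong' refl) (auto simp: finsum_ldistr emb_sum Pi_def)
    also have "\<dots> = (\<Oplus>i\<in>below N. \<Oplus>j\<in>below N. \<Oplus>l\<in>below N.
        emb (\<Sum>k\<in>below N. c j l k * c i k n) \<otimes> p i j l)"
      using p c_assoc True by (intro finsum_cong' refl) (auto simp: below_def N_def intro!: finsum_closed)
    also have "\<dots> = (\<Oplus>i\<in>below N. \<Oplus>j\<in>below N. \<Oplus>l\<in>below N. \<Oplus>k\<in>below N.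
        emb (c j l k * c i k n) \<otimes> p i j l)"
      using p by (intro finsum_cong' refl) (auto simp: finsum_ldistr emb_sum Pi_def)
    also have "\<dots> = (\<Oplus>i\<in>below N. \<Oplus>j\<in>below N. \<Oplus>k\<in>below N. \<Oplus>l\<in>below N.
        emb (c j l k * c i k n) \<otimes> p i j l)"
      using p by (intro finsum_cong' refl finsum_swap) (auto intro!: finsum_closed)
    also have "\<dots> = (\<Oplus>i\<in>below N. \<Oplus>k\<in>below N. \<Oplus>j\<in>below N. \<Oplus>l\<in>below N.
        emb (c j l k * c i k n) \<otimes> p i j l)"
      using p by (intro finsum_cong' refl finsum_swap) (auto intro!: finsum_closed)
    also have "\<dots> = (\<Oplus>i\<in>below N. \<Oplus>k\<in>below N. \<Oplus>j\<in>below N. \<Oplus>l\<in>below N.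
        emb (c i k n) \<otimes> (a i \<otimes> (emb (c j l k) \<otimes> (b j \<otimes> d l))))"
      using abd by (intro finsum_cong' refl) (auto simp: emb_mult p_def m_ac intro!: finsum_closed)
    also have "\<dots> = (\<Oplus>i\<in>below N. \<Oplus>k\<in>below N. emb (c i k n) \<otimes>
        (a i \<otimes> (\<Oplus>j\<in>below N. \<Oplus>l\<in>below N. emb (c j l k) \<otimes> (b j \<otimes> d l))))"
      using abd by (intro finsum_cong' refl) (auto simp: finsum_ldistr finsum_rdistr Pi_def)
    also have "\<dots> = (\<Oplus>i\<in>below N. \<Oplus>k\<in>below N. emb (c i k n) \<otimes> (a i \<otimes> prodf b d k))"
      using abd by (intro finsum_cong' refl) (auto simp: prodf_eq[symmetric] intro!: finsum_closed)
    also have "\<dots> = prodf a (prodf b d) n"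
      using abd n by (intro prodf_eq[symmetric]) auto
    finally show ?thesis .
  qed
qed

lemma prodf_single_left:
  assumes a: "a \<in> carrier salg" "j \<in> I" "x \<in> carrier F"
    and "b = (\<lambda>i. if i = j then x else \<zero>)" "k \<in> I"
  shows "prodf b a k = (\<Oplus>l\<in>below (wt k). emb (c j l k) \<otimes> (x \<otimes> a l))"
proof -
  have "prodf b a k = (\<Oplus>l\<in>below (wt k). \<Oplus>i\<in>below (wt k). emb (c i l k) \<otimes> (b i \<otimes> a l))"
    using assms by (auto simp: prodf_def intro!: finsum_swap)
  also have "\<dots> = (\<Oplus>l\<in>below (wt k). emb (c j l k) \<otimes> (x \<otimes> a l))"
  proof (intro finsum_cong' refl)
    fix l assume l: "l \<in> below (wt k)"
    have "(\<Oplus>i\<in>below (wt k). emb (c i l k) \<otimes> (b i \<otimes> a l))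
        = (\<Oplus>i\<in>below (wt k) \<inter> {j}. emb (c i l k) \<otimes> (b i \<otimes> a l))"
      using assms by (intro add.finprod_mono_neutral_cong_right) auto
    also have "\<dots> = emb (c j l k) \<otimes> (x \<otimes> a l)"
    proof (cases "j \<in> below (wt k)")
      case True
      then show ?thesis using assms by simp
    next
      case False
      then show ?thesis using assms l c_below[of j l k "wt k"] by (simp add: below_def)
    qed
    finally show "(\<Oplus>i\<in>below (wt k). emb (c i l k) \<otimes> (b i \<otimes> a l)) = emb (c j l k) \<otimes> (x \<otimes> a l)" .
  qed (use assms in auto)
  finally show ?thesis .
qed

lemma prodf_single_right:
  assumes a: "a \<in> carrier salg" "j \<in> I" "x \<in> carrier F"
    and "b = (\<lambda>i. if i = j then x else \<zero>)" "k \<in> I"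
  shows "prodf a b k = (\<Oplus>l\<in>below (wt k). emb (c l j k) \<otimes> (a l \<otimes> x))"
proof -
  have "prodf a b k = (\<Oplus>l\<in>below (wt k). \<Oplus>i\<in>below (wt k). emb (c l i k) \<otimes> (a l \<otimes> b i))"
    using assms by (simp add: prodf_def)
  also have "\<dots> = (\<Oplus>l\<in>below (wt k). emb (c l j k) \<otimes> (a l \<otimes> x))"
  proof (intro finsum_cong' refl)
    fix l assume l: "l \<in> below (wt k)"
    have "(\<Oplus>i\<in>below (wt k). emb (c l i k) \<otimes> (a l \<otimes> b i))
        = (\<Oplus>i\<in>below (wt k) \<inter> {j}. emb (c l i k) \<otimes> (a l \<otimes> b i))"
      using assms by (intro add.finprod_mono_neutral_cong_right) auto
    also have "\<dots> = emb (c l j k) \<otimes> (a l \<otimes> x)"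
    proof (cases "j \<in> below (wt k)")
      case True
      then show ?thesis using assms by simp
    next
      case False
      then show ?thesis using assms l c_below[of l j k "wt k"] by (simp add: below_def)
    qed
    finally show "(\<Oplus>i\<in>below (wt k). emb (c l i k) \<otimes> (a l \<otimes> b i)) = emb (c l j k) \<otimes> (a l \<otimes> x)" .
  qed (use assms in auto)
  finally show ?thesis .
qed

lemma prodf_one:
  assumes "a \<in> carrier salg"
  shows "prodf (\<lambda>i. if i = e then \<one> else \<zero>) a = a" "prodf a (\<lambda>i. if i = e then \<one> else \<zero>) = a"
proof -
  have *: "(\<Oplus>l\<in>below (wt k). emb (if l = k then 1 else 0) \<otimes> a l) = a k" if "k \<in> I" for k
  proof -
    have "(\<Oplus>l\<in>below (wt k). emb (if l = k then 1 else 0) \<otimes> a l)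
        = (\<Oplus>l\<in>below (wt k). if k = l then a l else \<zero>)"
      using assms by (intro finsum_cong') auto
    also have "\<dots> = a k"
      using assms that by (intro add.finprod_singleton) (auto simp: below_def finite_weight_le)
    finally show ?thesis .
  qed
  show "prodf (\<lambda>i. if i = e then \<one> else \<zero>) a = a"
  proof
    fix k
    show "prodf (\<lambda>i. if i = e then \<one> else \<zero>) a k = a k"
    proof (cases "k \<in> I")
      case True
      have "prodf (\<lambda>i. if i = e then \<one> else \<zero>) a k = (\<Oplus>l\<in>below (wt k). emb (c e l k) \<otimes> (\<one> \<otimes> a l))"
        using assms True unit_in by (intro prodf_single_left) auto
      also have "\<dots> = (\<Oplus>l\<in>below (wt k). emb (if l = k then 1 else 0) \<otimes> a l)"
        using assms True unit_left by (intro finsum_cong') (auto simp: below_def)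
      finally show ?thesis using *[OF True] by simp
    qed (use assms in \<open>simp add: prodf_def mem_salg\<close>)
  qed
  show "prodf a (\<lambda>i. if i = e then \<one> else \<zero>) = a"
  proof
    fix k
    show "prodf a (\<lambda>i. if i = e then \<one> else \<zero>) k = a k"
    proof (cases "k \<in> I")
      case True
      have "prodf a (\<lambda>i. if i = e then \<one> else \<zero>) k = (\<Oplus>l\<in>below (wt k). emb (c l e k) \<otimes> (a l \<otimes> \<one>))"
        using assms True unit_in by (intro prodf_single_right) auto
      also have "\<dots> = (\<Oplus>l\<in>below (wt k). emb (if l = k then 1 else 0) \<otimes> a l)"
        using assms True unit_right by (intro finsum_cong') (auto simp: below_def)
      finally show ?thesis using *[OF True] by simp
    qed (use assms in \<open>simp add: prodf_def mem_salg\<close>)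
  qed
qed

lemma finsum2_addf:
  assumes "finite A" "\<And>i j. f i j \<in> carrier F" "\<And>i j. g i j \<in> carrier F"
  shows "(\<Oplus>i\<in>A. \<Oplus>j\<in>A. f i j \<oplus> g i j) = (\<Oplus>i\<in>A. \<Oplus>j\<in>A. f i j) \<oplus> (\<Oplus>i\<in>A. \<Oplus>j\<in>A. g i j)"
proof -
  have "(\<Oplus>j\<in>A. f i j \<oplus> g i j) = (\<Oplus>j\<in>A. f i j) \<oplus> (\<Oplus>j\<in>A. g i j)" for i
    using assms by (intro finsum_addf) auto
  then show ?thesis using assms by (simp add: finsum_addf Pi_def)
qed

lemma finsum2_rdistr:
  assumes "finite A" "\<And>i j. f i j \<in> carrier F" "x \<in> carrier F"
  shows "x \<otimes> (\<Oplus>i\<in>A. \<Oplus>j\<in>A. f i j) = (\<Oplus>i\<in>A. \<Oplus>j\<in>A. x \<otimes> f i j)"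
proof -
  have "x \<otimes> (\<Oplus>j\<in>A. f i j) = (\<Oplus>j\<in>A. x \<otimes> f i j)" for i
    using assms by (intro finsum_rdistr) auto
  then show ?thesis using assms by (simp add: finsum_rdistr Pi_def)
qed

lemma prodf_distr:
  assumes "a \<in> carrier salg" "b \<in> carrier salg" "d \<in> carrier salg"
  shows "prodf (\<lambda>i. a i \<oplus> b i) d = (\<lambda>i. prodf a d i \<oplus> prodf b d i)"
    and "prodf d (\<lambda>i. a i \<oplus> b i) = (\<lambda>i. prodf d a i \<oplus> prodf d b i)"
  using assms by (auto simp: prodf_def l_distr r_distr finsum2_addf)

lemma prodf_smult:
  assumes "a \<in> carrier salg" "b \<in> carrier salg" "x \<in> carrier F"
  shows "prodf (\<lambda>i. x \<otimes> a i) b = (\<lambda>i. x \<otimes> prodf a b i)"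
    and "prodf a (\<lambda>i. x \<otimes> b i) = (\<lambda>i. x \<otimes> prodf a b i)"
proof -
  have "emb n \<otimes> (x \<otimes> a i \<otimes> b j) = x \<otimes> (emb n \<otimes> (a i \<otimes> b j))"
    "emb n \<otimes> (a i \<otimes> (x \<otimes> b j)) = x \<otimes> (emb n \<otimes> (a i \<otimes> b j))" for n i j
    using assms by (simp_all add: m_ac)
  then show "prodf (\<lambda>i. x \<otimes> a i) b = (\<lambda>i. x \<otimes> prodf a b i)"
    and "prodf a (\<lambda>i. x \<otimes> b i) = (\<lambda>i. x \<otimes> prodf a b i)"
    using assms by (auto simp: prodf_def finsum2_rdistr)
qed

lemma abelian_group_salg: "abelian_group salg"
proof (rule abelian_groupI)
  fix a assume a: "a \<in> carrier salg"
  show "\<exists>b\<in>carrier salg. b \<oplus>\<^bsub>salg\<^esub> a = \<zero>\<^bsub>salg\<^esub>"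
    using a by (intro bexI[of _ "\<lambda>i. \<ominus> a i"]) (auto simp: mem_salg l_neg)
qed (auto simp: mem_salg a_ac)

theorem assoc_algebra_salg: "assoc_algebra F salg"
proof (rule assoc_algebra.intro)
  show "module F salg"
    by (rule moduleI[OF is_cring abelian_group_salg])
      (auto simp: mem_salg l_distr r_distr m_assoc fun_eq_iff)
  have "monoid salg"
    by (rule monoidI) (auto simp: prodf_assoc prodf_one, auto simp: mem_salg unit_in)
  then show "ring salg"
    by (intro ringI[OF abelian_group_salg]) (auto simp: prodf_distr)
  show "assoc_algebra_axioms F salg"
    by (rule assoc_algebra_axioms.intro) (auto simp: prodf_smult)
qed

text \<open>Elements may have infinite support, so the argument uses their components of lowest
  weight, which have finite support. A basis element that arises from exactly one pair of these
  supports has as its coefficient in the product a product of two nonzero scalars.\<close>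

theorem noncomm_domain_salg: "noncomm_domain salg"
proof -
  interpret S: assoc_algebra F salg by (rule assoc_algebra_salg)
  have lowest: "\<exists>N. {i\<in>I. a i \<noteq> \<zero> \<and> wt i = N} \<noteq> {} \<and> (\<forall>i\<in>I. a i \<noteq> \<zero> \<longrightarrow> N \<le> wt i)"
    if "a \<in> carrier salg" "a \<noteq> \<zero>\<^bsub>salg\<^esub>" for a
  proof -
    have "\<exists>N. \<exists>i\<in>I. a i \<noteq> \<zero> \<and> wt i = N"
      using that by (auto simp: mem_salg fun_eq_iff)
    then obtain N where N: "\<exists>i\<in>I. a i \<noteq> \<zero> \<and> wt i = N"
        "\<And>M. M < N \<Longrightarrow> \<not> (\<exists>i\<in>I. a i \<noteq> \<zero> \<and> wt i = M)"
      unfolding exists_least_iff[of "\<lambda>N. \<exists>i\<in>I. a i \<noteq> \<zero> \<and> wt i = N"] by blast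
    show ?thesis
    proof (intro exI[of _ N] conjI ballI impI)
      fix i assume "i \<in> I" "a i \<noteq> \<zero>"
      then show "N \<le> wt i" using N(2)[of "wt i"] by (intro leI) blast
    qed (use N(1) in blast)
  qed
  show ?thesis
  proof (intro noncomm_domain.intro noncomm_domain_axioms.intro S.ring_axioms)
    show "\<one>\<^bsub>salg\<^esub> \<noteq> \<zero>\<^bsub>salg\<^esub>" by (auto simp: fun_eq_iff)
    fix a b assume ab: "a \<otimes>\<^bsub>salg\<^esub> b = \<zero>\<^bsub>salg\<^esub>" "a \<in> carrier salg" "b \<in> carrier salg"
    show "a = \<zero>\<^bsub>salg\<^esub> \<or> b = \<zero>\<^bsub>salg\<^esub>"
    proof (rule ccontr)
      assume "\<not> (a = \<zero>\<^bsub>salg\<^esub> \<or> b = \<zero>\<^bsub>salg\<^esub>)"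
      then have ne: "a \<noteq> \<zero>\<^bsub>salg\<^esub>" "b \<noteq> \<zero>\<^bsub>salg\<^esub>" by blast+
      obtain M where M: "{i\<in>I. a i \<noteq> \<zero> \<and> wt i = M} \<noteq> {}" "\<And>i. i \<in> I \<Longrightarrow> a i \<noteq> \<zero> \<Longrightarrow> M \<le> wt i"
        using lowest[OF ab(2) ne(1)] by blast
      obtain N where N: "{i\<in>I. b i \<noteq> \<zero> \<and> wt i = N} \<noteq> {}" "\<And>i. i \<in> I \<Longrightarrow> b i \<noteq> \<zero> \<Longrightarrow> N \<le> wt i"
        using lowest[OF ab(3) ne(2)] by blast
      define A B where "A = {i\<in>I. a i \<noteq> \<zero> \<and> wt i = M}" and "B = {i\<in>I. b i \<noteq> \<zero> \<and> wt i = N}"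
      have "finite A" "finite B"
        unfolding A_def B_def
        by (rule finite_subset[OF _ finite_weight_le[of M]], force)
          (rule finite_subset[OF _ finite_weight_le[of N]], force)
      moreover have "A \<subseteq> I" "B \<subseteq> I" "A \<noteq> {}" "B \<noteq> {}"
        using M(1) N(1) by (auto simp only: A_def B_def)
      ultimately obtain i j k where ij: "i \<in> A" "j \<in> B" "k \<in> I" "c i j k = 1"
        and uniq: "\<And>i' j'. i' \<in> A \<Longrightarrow> j' \<in> B \<Longrightarrow> c i' j' k \<noteq> 0 \<Longrightarrow> i' = i \<and> j' = j"
        using unique_product[of A B] by blast
      have I: "i \<in> I" "j \<in> I" and wk: "wt k = M + N" and nz: "a i \<noteq> \<zero>" "b j \<noteq> \<zero>"
        using weight_add[of i j k] ij by (auto simp: A_def B_def)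
      \<comment> \<open>A nonzero contribution needs indices of weights at least \<open>M\<close>
        and \<open>N\<close> with sum \<open>M + N\<close>. So they lie in \<open>A\<close> and
        \<open>B\<close>, where the pair is unique.\<close>
      have 0: "emb (c i' j' k) \<otimes> (a i' \<otimes> b j') = \<zero>"
        if "i' \<in> below (wt k)" "j' \<in> below (wt k)" "i' \<noteq> i \<or> j' \<noteq> j" for i' j'
      proof (rule ccontr)
        assume ne: "\<not> ?thesis"
        then have *: "a i' \<noteq> \<zero>" "b j' \<noteq> \<zero>" "c i' j' k \<noteq> 0" using ab by auto
        then have "wt k = wt i' + wt j'" "M \<le> wt i'" "N \<le> wt j'"
          using weight_add[of i' j' k] M(2) N(2) that ij by (auto simp: below_def)
        then show False using uniq[of i' j'] * that wk by (auto simp: A_def B_def below_def)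
      qed
      have inb: "i \<in> below (wt k)" "j \<in> below (wt k)"
        using ij I wk by (auto simp: below_def A_def B_def)
      have "prodf a b k = (\<Oplus>i'\<in>below (wt k). \<Oplus>j'\<in>below (wt k). emb (c i' j' k) \<otimes> (a i' \<otimes> b j'))"
        using ij by (simp add: prodf_def)
      also have "\<dots> = (\<Oplus>i'\<in>{i}. \<Oplus>j'\<in>below (wt k). emb (c i' j' k) \<otimes> (a i' \<otimes> b j'))"
        using ab inb by (intro add.finprod_mono_neutral_cong_right) (auto intro!: add.finprod_one_eqI 0)
      also have "\<dots> = (\<Oplus>j'\<in>below (wt k). emb (c i j' k) \<otimes> (a i \<otimes> b j'))"
        using ab by simp
      also have "\<dots> = (\<Oplus>j'\<in>{j}. emb (c i j' k) \<otimes> (a i \<otimes> b j'))"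
        using ab inb by (intro add.finprod_mono_neutral_cong_right) (auto intro!: 0)
      also have "\<dots> = a i \<otimes> b j"
        using ab ij by simp
      also have "\<dots> \<noteq> \<zero>"
        using nz ab integral_iff by simp
      finally show False using ab(1) by simp
    qed
  qed
qed

end

section \<open>Generated subalgebras and their growth\<close>


lemma (in ring) Span_dimension_le:
  assumes "subfield K R" "set Us \<subseteq> carrier R"
  shows "\<exists>m\<le>length Us. dimension m K (Span K Us)"
  using assms(2)
proof (induction Us)
  case Nil
  then show ?case by auto
next
  case (Cons u Us)
  then obtain m where m: "m \<le> length Us" "dimension m K (Span K Us)" by auto
  show ?case
  proof (cases "u \<in> Span K Us")
    case True
    have "set (u # Us) \<subseteq> Span K Us"
      using True Span_base_incl[OF assms(1), of Us] Cons.prems by auto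
    then have "Span K (u # Us) \<subseteq> Span K Us"
      using Cons.prems by (intro subalgebra_Span_incl[OF assms(1) Span_is_subalgebra[OF assms(1)]]) auto
    moreover have "Span K Us \<subseteq> Span K (u # Us)"
      using Cons.prems by (intro mono_Span[OF assms(1)]) auto
    ultimately have "Span K (u # Us) = Span K Us" by blast
    then show ?thesis using m by (intro exI[of _ m]) (simp del: Span.simps)
  next
    case False
    then show ?thesis using m Cons.prems Suc_dim[of u "Span K Us" m K] by auto
  qed
qed

text \<open>An independent list of greatest length spans \<open>V\<close>, as a vector outside its
  span would extend it. This gives finite dimension without a spanning list being exhibited.\<close>

lemma (in ring) dimension_of_bounded_independent:
  assumes K: "subfield K R" and V: "subalgebra K V R"
    and bound: "\<And>Us. set Us \<subseteq> V \<Longrightarrow> independent K Us \<Longrightarrow> length Us \<le> N"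
  obtains m where "dimension m K V" "m \<le> N"
proof -
  define P where "P n \<longleftrightarrow> (\<exists>Us. set Us \<subseteq> V \<and> independent K Us \<and> length Us = n)" for n
  have P: "P n \<Longrightarrow> n \<le> N" for n using bound by (auto simp: P_def)
  have "P 0" by (auto simp: P_def)
  then have "P (Greatest P)" and greatest: "\<And>n. P n \<Longrightarrow> n \<le> Greatest P"
    using P by (blast intro: GreatestI_nat Greatest_le_nat)+
  then obtain Us where Us: "set Us \<subseteq> V" "independent K Us" "length Us = Greatest P"
    by (auto simp: P_def)
  have "Span K Us = V"
  proof (rule ccontr)
    assume "Span K Us \<noteq> V"
    then obtain v where v: "v \<in> V" "v \<notin> Span K Us"
      using subalgebra_Span_incl[OF K V Us(1)] by blast
    then have "independent K (v # Us)"
      using Us(2) subalgebra_in_carrier[OF V] by (intro li_Cons) auto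
    then have "P (Suc (Greatest P))"
      using v(1) Us unfolding P_def by (intro exI[of _ "v # Us"]) auto
    then show False using greatest by fastforce
  qed
  then show thesis
    using that dimension_independent[OF Us(2)] Us P \<open>P (Greatest P)\<close> by metis
qed

section \<open>Subspaces, power sums and generated subalgebras\<close>

context assoc_algebra
begin

lemma scalar_mult: "\<lbrakk>a \<in> carrier R; x \<in> carrier M\<rbrakk> \<Longrightarrow> (a \<odot>\<^bsub>M\<^esub> \<one>\<^bsub>M\<^esub>) \<otimes>\<^bsub>M\<^esub> x = a \<odot>\<^bsub>M\<^esub> x"
  by (simp add: smult_mult_left)

lemma subfield_scalars:
  assumes "field R" "\<one>\<^bsub>M\<^esub> \<noteq> \<zero>\<^bsub>M\<^esub>"
  shows "subfield (scalars R M) M"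
proof -
  have "ring_hom_ring R M (\<lambda>a. a \<odot>\<^bsub>M\<^esub> \<one>\<^bsub>M\<^esub>)"
    by (rule ring_hom_ringI)
      (auto simp: R.ring_axioms ring_axioms smult_l_distr scalar_mult smult_assoc1)
  then show ?thesis
    unfolding scalars_def
    using ring_hom_ring.img_is_subfield(2) field.carrier_is_subfield assms by blast
qed

lemma subalgebra_of_submodule:
  assumes "submodule U R M"
  shows "subalgebra (scalars R M) U M"
proof (intro subalgebra.intro subalgebra_axioms.intro)
  show "subgroup U (add_monoid M)" using assms by (rule submodule.axioms)
  fix k v assume "k \<in> scalars R M" "v \<in> U"
  then show "k \<otimes>\<^bsub>M\<^esub> v \<in> U"
    using submoduleE(1,4)[OF assms] scalar_mult by (auto simp: scalars_def)
qed

lemma submodule_zero: "submodule U R M \<Longrightarrow> \<zero>\<^bsub>M\<^esub> \<in> U"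
  using subgroup.one_closed[OF submodule.axioms(1)] by fastforce

lemma submodule_linear_span:
  assumes "X \<subseteq> carrier M"
  shows "submodule (linear_span R M X) R M"
proof (rule submoduleI)
  show "linear_span R M X \<subseteq> carrier M"
    using carrier_is_submodule assms by (auto simp: linear_span_def)
  show "\<zero>\<^bsub>M\<^esub> \<in> linear_span R M X"
    by (auto simp: linear_span_def submodule_zero)
  show "a \<oplus>\<^bsub>M\<^esub> b \<in> linear_span R M X"
    if "a \<in> linear_span R M X" "b \<in> linear_span R M X" for a b
    using that submoduleE(5) unfolding linear_span_def by blast
qed (auto simp: linear_span_def dest: submoduleE(3,4))

lemma linear_span_base: "X \<subseteq> linear_span R M X"
  and linear_span_min: "submodule U R M \<Longrightarrow> X \<subseteq> U \<Longrightarrow> linear_span R M X \<subseteq> U"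
  by (auto simp: linear_span_def)

lemma submodule_set_add:
  assumes U: "submodule U R M" and W: "submodule W R M"
  shows "submodule (U <+>\<^bsub>M\<^esub> W) R M"
proof (rule submoduleI)
  have c: "u \<in> carrier M" if "u \<in> U \<or> u \<in> W" for u
    using that submoduleE(1) U W by blast
  note mem = set_add_def set_mult_def
  show "U <+>\<^bsub>M\<^esub> W \<subseteq> carrier M" by (auto simp: mem c)
  show "\<zero>\<^bsub>M\<^esub> \<in> U <+>\<^bsub>M\<^esub> W"
    using submodule_zero[OF U] submodule_zero[OF W] by (force simp: mem)
  fix a assume "a \<in> U <+>\<^bsub>M\<^esub> W"
  then obtain u w where a: "a = u \<oplus>\<^bsub>M\<^esub> w" and uw: "u \<in> U" "w \<in> W" by (auto simp: mem)
  have "\<ominus>\<^bsub>M\<^esub> a = \<ominus>\<^bsub>M\<^esub> u \<oplus>\<^bsub>M\<^esub> \<ominus>\<^bsub>M\<^esub> w"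
    using uw c by (simp add: a M.minus_add)
  then show "\<ominus>\<^bsub>M\<^esub> a \<in> U <+>\<^bsub>M\<^esub> W"
    using submoduleE(3)[OF U uw(1)] submoduleE(3)[OF W uw(2)] by (auto simp: mem)
  fix b assume "b \<in> U <+>\<^bsub>M\<^esub> W"
  then obtain u' w' where b: "b = u' \<oplus>\<^bsub>M\<^esub> w'" and uw': "u' \<in> U" "w' \<in> W" by (auto simp: mem)
  have "a \<oplus>\<^bsub>M\<^esub> b = (u \<oplus>\<^bsub>M\<^esub> u') \<oplus>\<^bsub>M\<^esub> (w \<oplus>\<^bsub>M\<^esub> w')"
    using uw uw' c by (simp add: a b M.a_ac)
  then show "a \<oplus>\<^bsub>M\<^esub> b \<in> U <+>\<^bsub>M\<^esub> W"
    using submoduleE(5)[OF U uw(1) uw'(1)] submoduleE(5)[OF W uw(2) uw'(2)] by (auto simp: mem)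
next
  have c: "u \<in> carrier M" if "u \<in> U \<or> u \<in> W" for u
    using that submoduleE(1) U W by blast
  fix k a assume "k \<in> carrier R" "a \<in> U <+>\<^bsub>M\<^esub> W"
  then obtain u w where a: "a = u \<oplus>\<^bsub>M\<^esub> w" and uw: "u \<in> U" "w \<in> W"
    by (auto simp: set_add_def set_mult_def)
  then have "k \<odot>\<^bsub>M\<^esub> a = k \<odot>\<^bsub>M\<^esub> u \<oplus>\<^bsub>M\<^esub> k \<odot>\<^bsub>M\<^esub> w"
    using \<open>k \<in> carrier R\<close> c by (simp add: smult_r_distr)
  then show "k \<odot>\<^bsub>M\<^esub> a \<in> U <+>\<^bsub>M\<^esub> W"
    using submoduleE(4)[OF U \<open>k \<in> carrier R\<close> uw(1)] submoduleE(4)[OF W \<open>k \<in> carrier R\<close> uw(2)]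
    by (auto simp: set_add_def set_mult_def)
qed

lemma submodule_scalars: "submodule (scalars R M) R M"
proof (rule submoduleI)
  show "\<zero>\<^bsub>M\<^esub> \<in> scalars R M"
    unfolding scalars_def by (rule image_eqI[of _ _ "\<zero>\<^bsub>R\<^esub>"]) auto
  fix x assume "x \<in> scalars R M"
  then obtain a where a: "a \<in> carrier R" "x = a \<odot>\<^bsub>M\<^esub> \<one>\<^bsub>M\<^esub>" by (auto simp: scalars_def)
  then show "\<ominus>\<^bsub>M\<^esub> x \<in> scalars R M"
    unfolding scalars_def by (intro image_eqI[of _ _ "\<ominus>\<^bsub>R\<^esub> a"]) (auto simp: smult_l_minus)
  fix y assume "y \<in> scalars R M"
  then obtain b where b: "b \<in> carrier R" "y = b \<odot>\<^bsub>M\<^esub> \<one>\<^bsub>M\<^esub>" by (auto simp: scalars_def)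
  then show "x \<oplus>\<^bsub>M\<^esub> y \<in> scalars R M"
    using a unfolding scalars_def by (intro image_eqI[of _ _ "a \<oplus>\<^bsub>R\<^esub> b"]) (auto simp: smult_l_distr)
next
  fix k x assume k: "k \<in> carrier R" and "x \<in> scalars R M"
  then obtain a where a: "a \<in> carrier R" "x = a \<odot>\<^bsub>M\<^esub> \<one>\<^bsub>M\<^esub>" by (auto simp: scalars_def)
  then show "k \<odot>\<^bsub>M\<^esub> x \<in> scalars R M"
    using k unfolding scalars_def by (intro image_eqI[of _ _ "k \<otimes>\<^bsub>R\<^esub> a"]) (auto simp: smult_assoc1)
qed (auto simp: scalars_def)

lemma one_in_scalars: "\<one>\<^bsub>M\<^esub> \<in> scalars R M"
  unfolding scalars_def by (rule image_eqI[of _ _ "\<one>\<^bsub>R\<^esub>"]) auto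

lemma submodule_subspace_power:
  assumes "submodule V R M"
  shows "submodule (subspace_power R M V n) R M"
proof (induction n)
  case 0
  then show ?case by (simp add: submodule_scalars)
next
  case (Suc n)
  then show ?case
    using submoduleE(1)[OF assms] submoduleE(1)[OF Suc]
    by (auto intro!: submodule_linear_span)
qed

lemma submodule_power_sum:
  assumes "submodule V R M"
  shows "submodule (power_sum R M V n) R M"
  using submodule_subspace_power[OF assms]
  by (induction n) (simp_all add: submodule_set_add del: subspace_power.simps)

lemma subspace_power_subset_power_sum:
  assumes "submodule V R M"
  shows "subspace_power R M V n \<subseteq> power_sum R M V n"
proof (cases n)
  case (Suc m)
  have "x = \<zero>\<^bsub>M\<^esub> \<oplus>\<^bsub>M\<^esub> x" if "x \<in> subspace_power R M V n" for x
    using that subsetD[OF submoduleE(1)[OF submodule_subspace_power[OF assms]] that] by simp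
  moreover have "\<zero>\<^bsub>M\<^esub> \<in> power_sum R M V m"
    by (intro submodule_zero submodule_power_sum assms)
  ultimately show ?thesis
    by (force simp: Suc set_add_def set_mult_def simp del: subspace_power.simps)
qed simp

text \<open>An ascending filtration that multiplication by \<open>V\<close> raises by one step
  contains the power sums; it is applied to the filtration by weight.\<close>

lemma power_sum_subset:
  assumes "\<And>n. submodule (U n) R M" "\<And>n. U n \<subseteq> U (Suc n)" "scalars R M \<subseteq> U 0"
    and "\<And>n x v. x \<in> U n \<Longrightarrow> v \<in> V \<Longrightarrow> x \<otimes>\<^bsub>M\<^esub> v \<in> U (Suc n)"
  shows "power_sum R M V n \<subseteq> U n"
proof -
  have pow: "subspace_power R M V n \<subseteq> U n" for n
  proof (induction n)
    case (Suc n)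
    then show ?case using assms(4) by (auto intro!: linear_span_min[OF assms(1)])
  qed (simp add: assms(3))
  show ?thesis
  proof (induction n)
    case 0
    then show ?case using pow[of 0] by simp
  next
    case (Suc n)
    have "x \<oplus>\<^bsub>M\<^esub> y \<in> U (Suc n)" if "x \<in> power_sum R M V n" "y \<in> subspace_power R M V (Suc n)" for x y
      using that Suc assms(2)[of n] pow[of "Suc n"] by (intro submoduleE(5)[OF assms(1)]) auto
    then show ?case by (auto simp: set_add_def set_mult_def simp del: subspace_power.simps)
  qed
qed

text \<open>The number \<open>growth\<close> is meaningful once the power sum is known to have a
  dimension. The bound on independent lists provides that dimension, and the two estimates compare
  with it.\<close>

lemma growth_bounds:
  assumes F: "field R" and one: "\<one>\<^bsub>M\<^esub> \<noteq> \<zero>\<^bsub>M\<^esub>" and V: "submodule V R M"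
    and bound: "\<And>Us. set Us \<subseteq> power_sum R M V n \<Longrightarrow> independent (scalars R M) Us \<Longrightarrow> length Us \<le> N"
  shows "growth R M V n \<le> N"
    and "\<lbrakk>set Us \<subseteq> power_sum R M V n; independent (scalars R M) Us\<rbrakk> \<Longrightarrow> length Us \<le> growth R M V n"
proof -
  note K = subfield_scalars[OF F one]
  obtain m where m: "dimension m (scalars R M) (power_sum R M V n)" "m \<le> N"
    using dimension_of_bounded_independent[OF K subalgebra_of_submodule[OF submodule_power_sum[OF V]] bound]
    by blast
  have "growth R M V n = m"
    using dimI[OF K m(1)] by (simp add: growth_def over_def)
  then show "growth R M V n \<le> N"
    "\<lbrakk>set Us \<subseteq> power_sum R M V n; independent (scalars R M) Us\<rbrakk> \<Longrightarrow> length Us \<le> growth R M V n"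
    using m independent_length_le_dimension[OF K m(1)] by auto
qed

definition gen_alg :: "'c set \<Rightarrow> ('a, 'c, 'd) module_scheme"
  where "gen_alg V = M\<lparr>carrier := generate_ring M (scalars R M \<union> V)\<rparr>"

lemma gen_alg_sel [simp]:
  "carrier (gen_alg V) = generate_ring M (scalars R M \<union> V)" "monoid.mult (gen_alg V) = monoid.mult M"
  "one (gen_alg V) = one M" "zero (gen_alg V) = zero M" "add (gen_alg V) = add M"
  "smult (gen_alg V) = smult M" "scalars R (gen_alg V) = scalars R M"
  by (simp_all add: gen_alg_def scalars_def)

lemma gen_alg:
  assumes V: "submodule V R M"
  shows "subring (generate_ring M (scalars R M \<union> V)) M"
    and "assoc_algebra R (gen_alg V)"
    and "submodule V R (gen_alg V)"
    and "generate_ring (gen_alg V) (scalars R (gen_alg V) \<union> V) = carrier (gen_alg V)"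
    and "noncomm_domain M \<Longrightarrow> noncomm_domain (gen_alg V)"
proof -
  let ?X = "scalars R M \<union> V" and ?H = "generate_ring M (scalars R M \<union> V)"
  have X: "?X \<subseteq> carrier M" using submoduleE(1)[OF V] submoduleE(1)[OF submodule_scalars] by blast
  show H: "subring ?H M" by (rule generate_ring_is_subring[OF X])
  have XH: "?X \<subseteq> ?H" by (rule subsetI) (rule generate_ring.incl)
  have HM: "?H \<subseteq> carrier M" by (rule generate_ring_incl[OF X])
  have smultH: "k \<odot>\<^bsub>M\<^esub> x \<in> ?H" if "k \<in> carrier R" "x \<in> ?H" for k x
  proof -
    have "k \<odot>\<^bsub>M\<^esub> \<one>\<^bsub>M\<^esub> \<in> ?H" 
      using that(1) by (intro subsetD[OF XH]) (simp add: scalars_def)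
    then have "(k \<odot>\<^bsub>M\<^esub> \<one>\<^bsub>M\<^esub>) \<otimes>\<^bsub>M\<^esub> x \<in> ?H" using that by (intro generate_ring.eng_mult)
    then show ?thesis using scalar_mult[OF that(1) subsetD[OF HM that(2)]] by simp
  qed
  have "submodule ?H R M"
    using subringE[OF H] smultH by (intro submoduleI) auto
  then have mod: "module R (gen_alg V)"
    unfolding gen_alg_def by (rule submodule.submodule_is_module) (rule module_axioms)
  have ring: "ring (gen_alg V)"
    unfolding gen_alg_def by (rule subring_is_ring[OF H])
  show alg: "assoc_algebra R (gen_alg V)"
    using mod ring HM
    by (intro assoc_algebra.intro assoc_algebra_axioms.intro)
      (simp_all add: smult_mult_left smult_mult_right subsetD[OF HM])
  interpret A: assoc_algebra R "gen_alg V" by (rule alg)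
  \<comment> \<open>Negation is defined relative to the carrier, so its agreement with negation in
    \<open>M\<close> requires uniqueness of inverses.\<close>
  have inv: "\<ominus>\<^bsub>gen_alg V\<^esub> x = \<ominus>\<^bsub>M\<^esub> x" if "x \<in> ?H" for x
    using that HM subringE(5)[OF H] 
    by (intro A.minus_equality) (auto simp: M.l_neg)
  show sub: "submodule V R (gen_alg V)"
    using XH submodule_zero[OF V] submoduleE[OF V] by (intro A.submoduleI) (auto simp: inv)
  show "generate_ring (gen_alg V) (scalars R (gen_alg V) \<union> V) = carrier (gen_alg V)"
  proof
    have X': "?X \<subseteq> carrier (gen_alg V)" using XH by simp
    show "generate_ring (gen_alg V) (scalars R (gen_alg V) \<union> V) \<subseteq> carrier (gen_alg V)"
      using A.generate_ring_incl[OF X'] by simp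
    have "x \<in> generate_ring (gen_alg V) ?X" if "x \<in> ?H" for x
      using that
    proof (induction rule: generate_ring.induct)
      case one
      show ?case using generate_ring.one[of "gen_alg V" ?X] by simp
    next
      case (incl h)
      then show ?case by (rule generate_ring.incl)
    next
      case (a_inv h)
      then show ?case using generate_ring.a_inv[OF a_inv.IH] by (simp add: inv)
    next
      case (eng_add h1 h2)
      then show ?case using generate_ring.eng_add[OF eng_add.IH] by simp
    next
      case (eng_mult h1 h2)
      then show ?case using generate_ring.eng_mult[OF eng_mult.IH] by simp
    qed
    then show "carrier (gen_alg V) \<subseteq> generate_ring (gen_alg V) (scalars R (gen_alg V) \<union> V)"
      by auto
  qed
  show "noncomm_domain (gen_alg V)" if "noncomm_domain M"
    using ring that HM
    by (intro noncomm_domain.intro noncomm_domain_axioms.intro)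
      (auto dest: noncomm_domain.one_not_zero noncomm_domain.integral)
qed

lemma submodule_Int_gen_alg:
  assumes V: "submodule V R M" and U: "submodule U R M"
  shows "submodule (U \<inter> carrier (gen_alg V)) R (gen_alg V)"
proof -
  interpret A: assoc_algebra R "gen_alg V" by (rule gen_alg(2)[OF V])
  show ?thesis
  proof (rule A.submoduleI)
    fix a assume a: "a \<in> U \<inter> carrier (gen_alg V)"
    then have "(\<ominus>\<^bsub>R\<^esub> \<one>\<^bsub>R\<^esub>) \<odot>\<^bsub>M\<^esub> a \<in> U"
      using submoduleE(4)[OF U] by simp
    moreover have "(\<ominus>\<^bsub>R\<^esub> \<one>\<^bsub>R\<^esub>) \<odot>\<^bsub>M\<^esub> a = \<ominus>\<^bsub>gen_alg V\<^esub> a"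
      using A.smult_l_minus[of "\<one>\<^bsub>R\<^esub>" a] A.smult_one[of a] a by simp
    ultimately show "\<ominus>\<^bsub>gen_alg V\<^esub> a \<in> U \<inter> carrier (gen_alg V)"
      using a by (metis A.a_inv_closed IntD2 IntI)
  next
    fix a b assume "a \<in> U \<inter> carrier (gen_alg V)" "b \<in> U \<inter> carrier (gen_alg V)"
    then show "a \<oplus>\<^bsub>gen_alg V\<^esub> b \<in> U \<inter> carrier (gen_alg V)"
      using submoduleE(5)[OF U] A.add.m_closed[of a b] by auto
  next
    fix k a assume "k \<in> carrier R" "a \<in> U \<inter> carrier (gen_alg V)"
    then show "k \<odot>\<^bsub>gen_alg V\<^esub> a \<in> U \<inter> carrier (gen_alg V)"
      using submoduleE(4)[OF U] A.smult_closed[of k a] by auto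
  qed (use submodule_zero[OF U] A.zero_closed in auto)
qed

text \<open>Spans are the same in a subring, hence so is independence. This allows dimensions in the
  generated algebra to be bounded by coordinates in the large one.\<close>

lemma independent_gen_alg:
  assumes "submodule V R M" "ring.independent (gen_alg V) K Us"
  shows "independent K Us"
proof -
  interpret A: assoc_algebra R "gen_alg V" using assms by (intro gen_alg)
  have span: "A.Span = Span"
    using Span_consistent[OF gen_alg(1)[OF assms(1)]] by (simp add: gen_alg_def)
  have carrier: "carrier (gen_alg V) \<subseteq> carrier M"
    using subringE(1)[OF gen_alg(1)[OF assms(1)]] by simp
  from assms(2) show ?thesis
  proof (induction K Us rule: A.independent.induct)
    case (li_Cons u K Us)
    then show ?case using carrier by (intro independent.li_Cons) (auto simp only: span)
  qed auto
qed

end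


section \<open>Growth of the subalgebra generated by basis elements of weight one\<close>

context graded_structure_constants
begin

sublocale S: assoc_algebra F salg
  by (rule assoc_algebra_salg)

definition single :: "'i \<Rightarrow> 'i \<Rightarrow> 'f"
  where "single j = (\<lambda>i. if i = j then \<one> else \<zero>)"

definition supported :: "'i set \<Rightarrow> ('i \<Rightarrow> 'f) set"
  where "supported J = {a \<in> carrier salg. \<forall>i. i \<notin> J \<longrightarrow> a i = \<zero>}"

definition word_elt :: "'i list \<Rightarrow> 'i \<Rightarrow> 'f"
  where "word_elt bs = foldl (\<lambda>p b. prodf p (single b)) (single e) bs"

lemma single_in_supported: "j \<in> I \<Longrightarrow> j \<in> J \<Longrightarrow> single j \<in> supported J"
  by (auto simp: single_def supported_def mem_salg)

lemma single_closed [simp]: "j \<in> I \<Longrightarrow> single j \<in> carrier salg"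
  by (auto simp: single_def mem_salg)

lemma a_inv_salg: "a \<in> carrier salg \<Longrightarrow> \<ominus>\<^bsub>salg\<^esub> a = (\<lambda>i. \<ominus> a i)"
  by (rule S.minus_equality) (auto simp: mem_salg l_neg)

lemma submodule_supported: "submodule (supported J) F salg"
  by (rule S.submoduleI) (auto simp: supported_def a_inv_salg, auto simp: mem_salg)

lemma mem_Span_single:
  assumes "distinct js" "set js \<subseteq> I" "a \<in> supported (set js)"
  shows "a \<in> S.Span (scalars F salg) (map single js)"
  using assms
proof (induction js arbitrary: a)
  case Nil
  then show ?case by (auto simp: supported_def)
next
  case (Cons j js)
  define a' where "a' = a(j := \<zero>)"
  have a: "a \<in> carrier salg" and a': "a' \<in> supported (set js)"
    using Cons.prems by (auto simp: supported_def mem_salg a'_def)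
  have "a' \<in> S.Span (scalars F salg) (map single js)"
    using Cons.prems by (intro Cons.IH a') simp_all
  moreover have "a = (a j \<odot>\<^bsub>salg\<^esub> \<one>\<^bsub>salg\<^esub>) \<otimes>\<^bsub>salg\<^esub> single j \<oplus>\<^bsub>salg\<^esub> a'"
  proof -
    have "(a j \<odot>\<^bsub>salg\<^esub> \<one>\<^bsub>salg\<^esub>) \<otimes>\<^bsub>salg\<^esub> single j = a j \<odot>\<^bsub>salg\<^esub> single j"
      using Cons.prems(2) a by (intro S.scalar_mult) auto
    moreover have "a = a j \<odot>\<^bsub>salg\<^esub> single j \<oplus>\<^bsub>salg\<^esub> a'"
      using a by (auto simp: single_def a'_def fun_eq_iff)
    ultimately show ?thesis by simp
  qed
  moreover have "a j \<odot>\<^bsub>salg\<^esub> \<one>\<^bsub>salg\<^esub> \<in> scalars F salg"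
    using a unfolding scalars_def by (intro imageI) simp
  ultimately have "a \<in> S.line_extension (scalars F salg) (single j) (S.Span (scalars F salg) (map single js))"
    unfolding S.line_extension_mem_iff by (intro bexI)
  then show ?case by simp
qed

lemma subfield_scalars: "subfield (scalars F salg) salg"
  by (rule S.subfield_scalars) (auto simp: field_axioms fun_eq_iff)

lemma independent_supported_length:
  assumes "finite J" "J \<subseteq> I" "set Us \<subseteq> supported J" "S.independent (scalars F salg) Us"
  shows "length Us \<le> card J"
proof -
  obtain js where js: "distinct js" "set js = J"
    using assms(1) finite_distinct_list by blast
  have "set (map single js) \<subseteq> carrier salg" using assms(2) js by auto
  then obtain m where "m \<le> length js" "S.dimension m (scalars F salg) (S.Span (scalars F salg) (map single js))"
    using S.Span_dimension_le[OF subfield_scalars, of "map single js"] by auto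
  moreover have "set Us \<subseteq> S.Span (scalars F salg) (map single js)"
    using mem_Span_single assms(2,3) js by blast
  ultimately have "length Us \<le> length js"
    using S.independent_length_le_dimension[OF subfield_scalars _ assms(4)] le_trans by blast
  then show ?thesis using js distinct_card by fastforce
qed

context
  fixes L :: "'i set"
  assumes L: "L \<subseteq> I" "finite L" and wt_L: "\<And>b. b \<in> L \<Longrightarrow> wt b = 1"
begin

abbreviation "V \<equiv> supported L"
abbreviation "A \<equiv> S.gen_alg V"

interpretation A: assoc_algebra F A
  by (rule S.gen_alg(2)[OF submodule_supported])

lemma A_one_not_zero: "\<one>\<^bsub>A\<^esub> \<noteq> \<zero>\<^bsub>A\<^esub>"
  by (auto simp: fun_eq_iff)

lemma wt_unit: "wt e = 0"
  using weight_add[of e e e] unit_in unit_left by simp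

lemma fin_dim_generating_supported: "fin_dim_generating_subspace F A V"
proof -
  have sub: "submodule V F A"
    by (rule S.gen_alg(3)[OF submodule_supported])
  have bound: "length Us \<le> card L" if "set Us \<subseteq> V" "A.independent (scalars F A) Us" for Us
    using independent_supported_length[OF L(2,1) that(1)]
      S.independent_gen_alg[OF submodule_supported that(2)] by simp
  obtain m where "A.dimension m (scalars F A) V"
    by (rule A.dimension_of_bounded_independent[OF A.subfield_scalars[OF field_axioms A_one_not_zero]
        A.subalgebra_of_submodule[OF sub]]) (rule bound)
  then have "A.finite_dimension (scalars F A) V"
    by (rule A.finite_dimensionI)
  then show ?thesis
    unfolding fin_dim_generating_subspace_def
    using sub S.gen_alg(4)[OF submodule_supported] by (intro conjI)
qed

text \<open>Weights add and every letter has weight one, so multiplication by \<open>V\<close> moves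
  support of weight at most \<open>n\<close> into weight at most \<open>Suc n\<close>. The
  coefficients at larger weights vanish term by term.\<close>

lemma power_sum_subset_supported: "power_sum F A V n \<subseteq> supported (below n) \<inter> carrier A"
proof (rule A.power_sum_subset)
  fix n
  show "submodule (supported (below n) \<inter> carrier A) F A"
    by (rule S.submodule_Int_gen_alg[OF submodule_supported submodule_supported])
  show "supported (below n) \<inter> carrier A \<subseteq> supported (below (Suc n)) \<inter> carrier A"
    by (auto simp: supported_def below_def)
  show "scalars F A \<subseteq> supported (below 0) \<inter> carrier A"
  proof
    fix x assume x: "x \<in> scalars F A"
    then have "x \<in> carrier A"
      using A.submoduleE(1)[OF A.submodule_scalars] by blast
    moreover have "x \<in> supported (below 0)"
      using x unit_in wt_unit by (auto simp: scalars_def supported_def below_def mem_salg)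
    ultimately show "x \<in> supported (below 0) \<inter> carrier A" by blast
  qed
  fix x v assume x: "x \<in> supported (below n) \<inter> carrier A" and v: "v \<in> V"
  have "prodf x v k = \<zero>" if "k \<notin> below (Suc n)" for k
  proof (cases "k \<in> I")
    case True
    have "emb (c i j k) \<otimes> (x i \<otimes> v j) = \<zero>" if "i \<in> I" "j \<in> I" for i j
    proof (rule ccontr)
      assume "\<not> ?thesis"
      then have "x i \<noteq> \<zero>" "v j \<noteq> \<zero>" "c i j k \<noteq> 0"
        using x v by (auto simp: supported_def)
      then have "i \<in> below n" "j \<in> L" "wt k = wt i + wt j"
        using x v weight_add[of i j k] that True by (auto simp: supported_def)
      then show False using \<open>k \<notin> below (Suc n)\<close> wt_L[of j] True by (auto simp: below_def)
    qed
    then show ?thesis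
      by (auto simp: prodf_def below_def intro!: add.finprod_one_eqI)
  qed (simp add: prodf_def)
  moreover have "x \<otimes>\<^bsub>A\<^esub> v \<in> carrier A"
    using x v subsetD[OF A.submoduleE(1)[OF S.gen_alg(3)[OF submodule_supported]], of v]
    by (intro A.m_closed) simp_all
  ultimately show "x \<otimes>\<^bsub>A\<^esub> v \<in> supported (below (Suc n)) \<inter> carrier A"
    using x v by (auto simp: supported_def)
qed

lemma growth_generated:
  shows "growth F A V n \<le> card (below n)"
    and "\<lbrakk>set Us \<subseteq> power_sum F A V n; A.independent (scalars F A) Us\<rbrakk> \<Longrightarrow> length Us \<le> growth F A V n"
proof -
  have "length Us \<le> card (below n)"
    if "set Us \<subseteq> power_sum F A V n" "A.independent (scalars F A) Us" for Us
  proof (rule independent_supported_length)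
    show "below n \<subseteq> I" by (auto simp: below_def)
    show "set Us \<subseteq> supported (below n)" using that(1) power_sum_subset_supported by blast
    show "S.independent (scalars F salg) Us"
      using S.independent_gen_alg[OF submodule_supported that(2)] by simp
  qed simp
  note bounds = A.growth_bounds[OF field_axioms A_one_not_zero S.gen_alg(3)[OF submodule_supported] this]
  show "growth F A V n \<le> card (below n)"
    "\<lbrakk>set Us \<subseteq> power_sum F A V n; A.independent (scalars F A) Us\<rbrakk> \<Longrightarrow> length Us \<le> growth F A V n"
    by (rule bounds; assumption)+
qed

lemma word_elt_in_power: "set bs \<subseteq> L \<Longrightarrow> word_elt bs \<in> subspace_power F A V (length bs)"
proof (induction bs rule: rev_induct)
  case Nil
  then show ?case
    using A.one_in_scalars by (simp add: word_elt_def single_def)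
next
  case (snoc b bs)
  have "single b \<in> V" using snoc.prems L by (intro single_in_supported) auto
  then have "prodf (word_elt bs) (single b) \<in> subspace_power F A V (Suc (length bs))"
    using snoc unfolding subspace_power.simps
    by (intro subsetD[OF A.linear_span_base]) auto
  then show ?case by (simp add: word_elt_def)
qed

lemma word_elt_closed: "set bs \<subseteq> L \<Longrightarrow> word_elt bs \<in> carrier salg"
  using L(1) unit_in by (induction bs rule: rev_induct) (auto simp: word_elt_def)

text \<open>Evaluation at the indices in \<open>ts\<close> is a dual system. The functions that
  vanish at the head index form a subspace that contains the tail but not the head.\<close>

lemma independent_dual:
  assumes "distinct ts" "\<And>t. t \<in> set ts \<Longrightarrow> p t \<in> carrier A"
    and "\<And>t t'. t \<in> set ts \<Longrightarrow> t' \<in> set ts \<Longrightarrow> p t t' = (if t = t' then \<one> else \<zero>)"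
  shows "A.independent (scalars F A) (map p ts)"
  using assms
proof (induction ts)
  case (Cons t ts)
  let ?U = "supported (- {t}) \<inter> carrier A"
  have U: "submodule ?U F A"
    by (rule S.submodule_Int_gen_alg[OF submodule_supported submodule_supported])
  have "carrier A \<subseteq> carrier salg"
    using subringE(1)[OF S.gen_alg(1)[OF submodule_supported]] by simp
  then have "set (map p ts) \<subseteq> ?U"
    using Cons.prems by (auto simp: supported_def)
  then have "A.Span (scalars F A) (map p ts) \<subseteq> ?U"
    by (intro A.subalgebra_Span_incl[OF A.subfield_scalars[OF field_axioms A_one_not_zero]]
        A.subalgebra_of_submodule U)
  moreover have "p t \<notin> ?U"
    using Cons.prems(3)[of t t] by (auto simp: supported_def)
  ultimately show ?case
    unfolding list.map
    by (intro A.independent.li_Cons Cons.IH) (use Cons.prems in \<open>auto simp del: S.gen_alg_sel\<close>)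
qed auto

context
  fixes T :: "'i set" and op :: "'i \<Rightarrow> 'i \<Rightarrow> 'i"
  assumes T: "T \<subseteq> I" "L \<subseteq> T" "e \<notin> T"
    and op: "\<And>l b. l \<in> T \<Longrightarrow> b \<in> L \<Longrightarrow> op l b \<in> T"
    and c_T: "\<And>l b t. l \<in> I \<Longrightarrow> b \<in> L \<Longrightarrow> t \<in> T \<Longrightarrow>
      c l b t = (if l = e \<and> b = t \<or> l \<in> T \<and> op l b = t then 1 else 0)"
begin

text \<open>By \<open>c_T\<close> the coefficients on \<open>T\<close> see only the operation
  \<open>op\<close>, so a product of letters has the coordinates of one element of \<open>T\<close>
  there, whatever its other terms are. The unit could feed into \<open>T\<close> as well; hence the
  induction also carries that its coefficient is zero.\<close>

lemma word_elt_coeff: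
  assumes "b \<in> L" "set bs \<subseteq> L"
  shows "word_elt (b # bs) e = \<zero>"
    and "t \<in> T \<Longrightarrow> word_elt (b # bs) t = (if foldl op b bs = t then \<one> else \<zero>)"
proof -
  have "word_elt (b # bs) e = \<zero> \<and> foldl op b bs \<in> T \<and>
      (\<forall>t\<in>T. word_elt (b # bs) t = (if foldl op b bs = t then \<one> else \<zero>))"
    using assms(2)
  proof (induction bs rule: rev_induct)
    case Nil
    have "word_elt [b] = single b"
      using assms(1) L(1) prodf_one(1)[of "single b"] by (auto simp: word_elt_def single_def[of e])
    then show ?case using assms(1) T by (auto simp: single_def)
  next
    case (snoc d bs)
    let ?w = "word_elt (b # bs)" and ?q = "foldl op b bs"
    have d: "d \<in> L" "d \<in> I" and w: "?w \<in> carrier salg" and q: "?q \<in> T"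
      using snoc L(1) assms(1) word_elt_closed[of "b # bs"] by auto
    have step: "word_elt (b # bs @ [d]) k = (\<Oplus>l\<in>below (wt k). emb (c l d k) \<otimes> (?w l \<otimes> \<one>))"
      if "k \<in> I" for k
      using that w d prodf_single_right[of ?w d \<one> "single d" k]
      by (simp add: word_elt_def single_def[of d])
    \<comment> \<open>The unit has weight 0, while a product with the letter \<open>d\<close> has
      weight at least 1.\<close>
    have "c l d e = 0" if "l \<in> I" for l
      using weight_add[of l d e] that d unit_in wt_unit wt_L[of d] by auto
    then have "word_elt (b # bs @ [d]) e = \<zero>"
      using w unit_in by (auto simp: step below_def intro!: add.finprod_one_eqI)
    moreover have "word_elt (b # bs @ [d]) t = (if op ?q d = t then \<one> else \<zero>)" if t: "t \<in> T" for t
    proof -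
      have "word_elt (b # bs @ [d]) t = (\<Oplus>l\<in>below (wt t). emb (c l d t) \<otimes> (?w l \<otimes> \<one>))"
        using t T by (intro step) auto
      also have "\<dots> = (\<Oplus>l\<in>below (wt t). if ?q = l then (if op l d = t then \<one> else \<zero>) else \<zero>)"
      proof (intro finsum_cong' refl)
        fix l assume "l \<in> below (wt t)"
        then have l: "l \<in> I" by (simp add: below_def)
        consider "l = e" | "l \<in> T" | "l \<notin> T" "l \<noteq> e" by blast
        then show "emb (c l d t) \<otimes> (?w l \<otimes> \<one>) = (if ?q = l then (if op l d = t then \<one> else \<zero>) else \<zero>)"
        proof cases
          case 1
          then show ?thesis using snoc q T by auto
        next
          case 2
          then show ?thesis using snoc c_T[OF l d(1) t] T by auto
        next
          case 3
          then show ?thesis using w q c_T[OF l d(1) t] by auto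
        qed
      qed auto
      also have "\<dots> = (if op ?q d = t then \<one> else \<zero>)"
      proof (cases "op ?q d = t")
        case True
        have I: "?q \<in> I" "t \<in> I" using q t T by auto
        then have "c ?q d t = 1" using c_T[of ?q d t] q d t True by auto
        \<comment> \<open>The only index that contributes must lie inside the truncated range of
          summation; additivity of weights ensures this.\<close>
        then have "?q \<in> below (wt t)"
          using weight_add[of ?q d t] d I by (auto simp: below_def)
        then show ?thesis by (subst add.finprod_singleton) auto
      next
        case False
        then show ?thesis by (auto intro!: add.finprod_one_eqI)
      qed
      finally show ?thesis .
    qed
    moreover have "op ?q d \<in> T" using op q d by blast
    ultimately show ?case by simp
  qed
  then show "word_elt (b # bs) e = \<zero>"
    "t \<in> T \<Longrightarrow> word_elt (b # bs) t = (if foldl op b bs = t then \<one> else \<zero>)"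
    by blast+
qed

text \<open>Each element of the set is reached by some product of \<open>n\<close> letters. By
  \<open>word_elt_coeff\<close> the chosen products are dual to the coordinates at these elements,
  so they are independent.\<close>

lemma growth_ge:
  "card {t\<in>T. \<exists>b bs. b \<in> L \<and> set bs \<subseteq> L \<and> Suc (length bs) = n \<and> foldl op b bs = t} \<le> growth F A V n"
    (is "card ?C \<le> _")
proof (cases "finite ?C")
  case True
  then obtain ts where ts: "distinct ts" "set ts = ?C"
    using finite_distinct_list[OF True] by (elim exE conjE)
  have "\<forall>t\<in>?C. \<exists>p. p \<in> subspace_power F A V n \<and> (\<forall>t'\<in>T. p t' = (if t = t' then \<one> else \<zero>))"
  proof
    fix t assume "t \<in> ?C"
    then obtain b bs where b: "b \<in> L" "set bs \<subseteq> L" "Suc (length bs) = n" "foldl op b bs = t"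
      by (elim CollectE exE conjE)
    then show "\<exists>p. p \<in> subspace_power F A V n \<and> (\<forall>t'\<in>T. p t' = (if t = t' then \<one> else \<zero>))"
      using word_elt_in_power[of "b # bs"] word_elt_coeff(2)[of b bs]
      by (intro exI[of _ "word_elt (b # bs)"]) auto
  qed
  from bchoice[OF this] obtain p where *: "\<forall>t\<in>?C. p t \<in> subspace_power F A V n
      \<and> (\<forall>t'\<in>T. p t t' = (if t = t' then \<one> else \<zero>))" ..
  then have p: "\<And>t. t \<in> ?C \<Longrightarrow> p t \<in> subspace_power F A V n"
      "\<And>t t'. t \<in> ?C \<Longrightarrow> t' \<in> T \<Longrightarrow> p t t' = (if t = t' then \<one> else \<zero>)"
    by blast+
  have V: "submodule V F A" by (rule S.gen_alg(3)[OF submodule_supported])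
  have mem: "set (map p ts) \<subseteq> power_sum F A V n"
    unfolding set_map ts(2) using p(1) subsetD[OF A.subspace_power_subset_power_sum[OF V, of n]]
    by (intro image_subsetI) (simp only:)
  have "A.independent (scalars F A) (map p ts)"
  proof (rule independent_dual[OF ts(1)])
    fix t assume t: "t \<in> set ts"
    show "p t \<in> carrier A"
      using p(1)[of t] t ts(2) subsetD[OF A.submoduleE(1)[OF A.submodule_subspace_power[OF V, of n]]]
      by (simp only:)
    fix t' assume "t' \<in> set ts"
    then show "p t t' = (if t = t' then \<one> else \<zero>)"
      using p(2)[of t t'] t ts(2) by simp
  qed
  then have "length (map p ts) \<le> growth F A V n"
    by (rule growth_generated(2)[OF mem])
  then show ?thesis using ts distinct_card[of ts] by simp
qed simp

end

end

end

section \<open>Counting words and multisets\<close>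


lemma card_multisets_count_le:
  fixes Y :: "'a set"
  assumes "finite Y"
  shows "finite {\<mu>. set_mset \<mu> \<subseteq> Y \<and> (\<forall>y. count \<mu> y \<le> N)}"
    and "card {\<mu>. set_mset \<mu> \<subseteq> Y \<and> (\<forall>y. count \<mu> y \<le> N)} \<le> (N + 1) ^ card Y"
proof -
  let ?S = "{\<mu>. set_mset \<mu> \<subseteq> Y \<and> (\<forall>y. count \<mu> y \<le> N)}" and ?E = "PiE Y (\<lambda>_. {..N})"
  let ?h = "\<lambda>\<mu> :: 'a multiset. restrict (count \<mu>) Y"
  have inj: "inj_on ?h ?S"
  proof (rule inj_onI, rule multiset_eqI)
    fix \<mu> \<nu> y assume *: "\<mu> \<in> ?S" "\<nu> \<in> ?S" and eq: "?h \<mu> = ?h \<nu>"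
    show "count \<mu> y = count \<nu> y"
    proof (cases "y \<in> Y")
      case True
      then show ?thesis using fun_cong[OF eq, of y] by simp
    next
      case False
      then have "y \<notin># \<mu>" "y \<notin># \<nu>" using * by auto
      then show ?thesis by (simp add: not_in_iff)
    qed
  qed
  have sub: "?h ` ?S \<subseteq> ?E" by auto
  have fin: "finite ?E" using assms by (auto intro!: finite_PiE)
  show "finite ?S" by (rule inj_on_finite[OF inj sub fin])
  have "card ?S \<le> card ?E" by (rule card_inj_on_le[OF inj sub fin])
  then show "card ?S \<le> (N + 1) ^ card Y" using assms by (simp add: card_PiE)
qed

text \<open>A multiset of size at most \<open>r\<close> is listed and padded with
  \<open>None\<close> to length exactly \<open>r\<close>; there are \<open>card Z + 1\<close>
  choices for each entry.\<close>

lemma card_multisets_size_le: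
  fixes Z :: "'a set"
  assumes "finite Z"
  shows "finite {\<mu>. set_mset \<mu> \<subseteq> Z \<and> size \<mu> \<le> r}"
    and "card {\<mu>. set_mset \<mu> \<subseteq> Z \<and> size \<mu> \<le> r} \<le> (card Z + 1) ^ r"
proof -
  let ?S = "{\<mu>. set_mset \<mu> \<subseteq> Z \<and> size \<mu> \<le> r}"
  let ?L = "{xs. set xs \<subseteq> insert None (Some ` Z) \<and> length xs = r}"
  let ?h = "\<lambda>xs :: 'a option list. mset (List.map_filter id xs)"
  have fin: "finite ?L" using assms by (intro finite_lists_length_eq) auto
  have "?S \<subseteq> ?h ` ?L"
  proof
    fix \<mu> assume \<mu>: "\<mu> \<in> ?S"
    obtain xs where xs: "mset xs = \<mu>" using ex_mset by blast
    define ys where "ys = map Some xs @ replicate (r - length xs) None"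
    have "List.map_filter id ys = xs"
      by (simp add: ys_def map_filter_def comp_def)
    moreover have "ys \<in> ?L"
      using \<mu> xs by (auto simp: ys_def)
    ultimately show "\<mu> \<in> ?h ` ?L" using xs by (intro image_eqI[of _ _ ys]) auto
  qed
  then show "finite ?S" and "card ?S \<le> (card Z + 1) ^ r"
    using finite_subset[of ?S "?h ` ?L"] fin assms surj_card_le[OF fin, of ?S ?h]
    by (auto simp: card_lists_length_eq card_image)
qed

text \<open>The multiset is split at length \<open>t\<close>. There are at most
  \<open>C * t ^ 2\<close> short words, each with multiplicity at most \<open>t ^ 3\<close>. Long
  words exceed length \<open>t\<close>, so at most \<open>t ^ 2\<close> occur, chosen among at most
  \<open>C * t ^ 6\<close>. With total length \<open>t ^ 3\<close> both exponents are of order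
  \<open>t ^ 2\<close>, the source of the power 2/3.\<close>

lemma card_multisets_weight_le:
  fixes len :: "'w \<Rightarrow> nat"
  assumes pos: "\<And>w. w \<in> W \<Longrightarrow> 0 < len w"
    and fin: "\<And>m. finite {w\<in>W. len w = m}"
    and le: "\<And>m. m \<le> t ^ 3 \<Longrightarrow> card {w\<in>W. len w = m} \<le> C * m"
  shows "card {\<mu>. set_mset \<mu> \<subseteq> W \<and> (\<Sum>w\<in>#\<mu>. len w) \<le> t ^ 3}
    \<le> (t ^ 3 + 1) ^ (C * t ^ 2) * (C * t ^ 6 + 1) ^ (t ^ 2)"
proof -
  let ?S = "{\<mu>. set_mset \<mu> \<subseteq> W \<and> (\<Sum>w\<in>#\<mu>. len w) \<le> t ^ 3}"
  have upto: "finite {w\<in>W. len w \<le> n}" "n \<le> t ^ 3 \<Longrightarrow> card {w\<in>W. len w \<le> n} \<le> C * n ^ 2" for n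
  proof -
    have eq: "{w\<in>W. len w \<le> n} = (\<Union>m\<in>{1..n}. {w\<in>W. len w = m})"
      using pos by (auto simp: Suc_le_eq)
    then show "finite {w\<in>W. len w \<le> n}" using fin by simp
    assume "n \<le> t ^ 3"
    then have "card {w\<in>W. len w \<le> n} \<le> (\<Sum>m\<in>{1..n}. C * n)"
      unfolding eq by (intro order_trans[OF card_UN_le] sum_mono order_trans[OF le] mult_le_mono) auto
    then show "card {w\<in>W. len w \<le> n} \<le> C * n ^ 2" by (simp add: power2_eq_square ac_simps)
  qed
  define Y where "Y = {w\<in>W. len w \<le> t}"
  define Z where "Z = {w\<in>W. len w \<le> t ^ 3}"
  have Y: "finite Y" "card Y \<le> C * t ^ 2"
    unfolding Y_def using upto[of t] self_le_power[of t 3] by (cases "t = 0"; simp)+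
  have Z: "finite Z" "card Z \<le> C * t ^ 6"
    using upto[of "t ^ 3"] by (simp_all add: Z_def power_mult[symmetric])
  define SY where "SY = {\<mu>. set_mset \<mu> \<subseteq> Y \<and> (\<forall>y. count \<mu> y \<le> t ^ 3)}"
  define SZ where "SZ = {\<mu>. set_mset \<mu> \<subseteq> Z \<and> size \<mu> \<le> t ^ 2}"
  have "?S \<subseteq> (\<lambda>(\<mu>, \<nu>). \<mu> + \<nu>) ` (SY \<times> SZ)"
  proof
    fix \<mu> assume \<mu>: "\<mu> \<in> ?S"
    define \<alpha> \<beta> where "\<alpha> = filter_mset (\<lambda>w. len w \<le> t) \<mu>" and "\<beta> = filter_mset (\<lambda>w. \<not> len w \<le> t) \<mu>"
    have part: "\<mu> = \<alpha> + \<beta>" unfolding \<alpha>_def \<beta>_def by (rule multiset_partition)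
    have sum: "(\<Sum>w\<in>#\<alpha>. len w) \<le> t ^ 3" "(\<Sum>w\<in>#\<beta>. len w) \<le> t ^ 3"
      using \<mu> by (simp_all add: part)
    have size_le: "k * size \<nu> \<le> (\<Sum>w\<in>#\<nu>. len w)" if "\<And>w. w \<in># \<nu> \<Longrightarrow> k \<le> len w" for k \<nu>
      using that by (induction \<nu>) (auto simp: algebra_simps intro!: add_mono)
    have "1 * size \<alpha> \<le> (\<Sum>w\<in>#\<alpha>. len w)"
      using \<mu> pos by (intro size_le) (auto simp: \<alpha>_def Suc_le_eq)
    then have "count \<alpha> y \<le> t ^ 3" for y
      using sum(1) count_le_size[of \<alpha> y] by linarith
    then have "\<alpha> \<in> SY" using \<mu> by (auto simp: SY_def Y_def \<alpha>_def)
    moreover have "\<beta> \<in> SZ"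
    proof -
      have "t * size \<beta> \<le> t ^ 3"
        using order_trans[OF size_le[of \<beta> t] sum(2)] by (auto simp: \<beta>_def)
      \<comment> \<open>For \<open>t = 0\<close> the previous inequality is empty; this one still
        gives size 0.\<close>
      moreover have "size \<beta> \<le> t ^ 3"
      proof -
        have "1 * size \<beta> \<le> (\<Sum>w\<in>#\<beta>. len w)"
          using \<mu> pos by (intro size_le) (auto simp: \<beta>_def Suc_le_eq)
        then show ?thesis using sum(2) by simp
      qed
      ultimately have "size \<beta> \<le> t ^ 2"
        by (cases "t = 0") (auto simp: power3_eq_cube power2_eq_square)
      moreover have "len w \<le> t ^ 3" if "w \<in># \<beta>" for w
      proof -
        have "(\<Sum>w\<in>#\<beta>. len w) = len w + (\<Sum>w\<in>#\<beta> - {#w#}. len w)"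
          using that by (metis image_mset_add_mset insert_DiffM sum_mset.add_mset)
        then show ?thesis using sum(2) by linarith
      qed
      ultimately show ?thesis using \<mu> by (auto simp: SZ_def Z_def part)
    qed
    ultimately show "\<mu> \<in> (\<lambda>(\<mu>, \<nu>). \<mu> + \<nu>) ` (SY \<times> SZ)" using part by auto
  qed
  moreover have fin: "finite SY" "finite SZ"
    unfolding SY_def SZ_def
    using card_multisets_count_le(1)[OF Y(1)] card_multisets_size_le(1)[OF Z(1)] by auto
  ultimately have "card ?S \<le> card (SY \<times> SZ)"
    by (intro surj_card_le) auto
  also have "\<dots> = card SY * card SZ" by (rule card_cartesian_product)
  also have "\<dots> \<le> (t ^ 3 + 1) ^ card Y * (card Z + 1) ^ (t ^ 2)"
    unfolding SY_def SZ_def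
    using card_multisets_count_le(2)[OF Y(1)] card_multisets_size_le(2)[OF Z(1)] by (intro mult_le_mono) auto
  also have "\<dots> \<le> (t ^ 3 + 1) ^ (C * t ^ 2) * (C * t ^ 6 + 1) ^ (t ^ 2)"
    using Y Z by (intro mult_le_mono power_increasing power_mono) auto
  finally show ?thesis .
qed

text \<open>The logarithm of the left side is of order \<open>t ^ 2 * ln t\<close>. The exponent 9/4
  is three times 3/4, to fit the later substitution of \<open>t ^ 3\<close> for
  \<open>n\<close>.\<close>

lemma eventually_count_bound:
  fixes C :: nat
  assumes "C > 0"
  shows "eventually (\<lambda>t::nat. real ((t ^ 3 + 1) ^ (C * t ^ 2) * (C * t ^ 6 + 1) ^ (t ^ 2))
    \<le> exp (real t powr (9/4))) at_top"
proof -
  define c where "c = real C"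
  have "c > 0" using assms by (simp add: c_def)
  then have "eventually (\<lambda>t::nat. c * real t ^ 2 * ln (real t ^ 3 + 1)
      + real t ^ 2 * ln (c * real t ^ 6 + 1) \<le> real t powr (9/4)) at_top"
    by real_asymp
  then show ?thesis
  proof eventually_elim
    case (elim t)
    have "real ((t ^ 3 + 1) ^ (C * t ^ 2) * (C * t ^ 6 + 1) ^ (t ^ 2))
        = exp (ln (real t ^ 3 + 1)) ^ (C * t ^ 2) * exp (ln (c * real t ^ 6 + 1)) ^ (t ^ 2)"
      using \<open>c > 0\<close> by (simp add: c_def add_nonneg_pos add_pos_nonneg add.commute)
    also have "\<dots> = exp (c * real t ^ 2 * ln (real t ^ 3 + 1) + real t ^ 2 * ln (c * real t ^ 6 + 1))"
      by (simp add: exp_add exp_of_nat_mult[symmetric] c_def mult.assoc)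
    also have "\<dots> \<le> exp (real t powr (9/4))" using elim by simp
    finally show ?case .
  qed
qed

section \<open>Binary words with forbidden differences between the positions of ones\<close>

definition sparse :: "nat set \<Rightarrow> bool list \<Rightarrow> bool"
  where "sparse X w \<longleftrightarrow> (\<forall>j<length w. \<forall>i<j. w ! i \<longrightarrow> w ! j \<longrightarrow> j - i \<notin> X)"

text \<open>The word of ones stands for the class of all bad words of its length. It realises every
  difference possible at that length, so it is itself bad as soon as one word of that length
  is.\<close>

definition nf :: "nat set \<Rightarrow> bool list \<Rightarrow> bool list"
  where "nf X w = (if sparse X w then w else replicate (length w) True)"

lemma sparse_appendD:
  assumes "sparse X (u @ v)"
  shows "sparse X u" "sparse X v"
proof -
  show "sparse X u"
    unfolding sparse_def
  proof (intro allI impI)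
    fix j i assume *: "j < length u" "i < j" "u ! i" "u ! j"
    then show "j - i \<notin> X"
      using assms[unfolded sparse_def, rule_format, of j i] by (auto simp: nth_append)
  qed
  show "sparse X v"
    unfolding sparse_def
  proof (intro allI impI)
    fix j i assume *: "j < length v" "i < j" "v ! i" "v ! j"
    then show "j - i \<notin> X"
      using assms[unfolded sparse_def, rule_format, of "length u + j" "length u + i"]
      by (auto simp: nth_append)
  qed
qed

lemma sparse_replicate_True:
  assumes "sparse X (replicate (length w) True)"
  shows "sparse X w"
  unfolding sparse_def
proof (intro allI impI)
  fix j i assume "j < length w" "i < j"
  then show "j - i \<notin> X"
    using assms[unfolded sparse_def, rule_format, of j i] by simp
qed

lemma length_nf [simp]: "length (nf X w) = length w"
  by (simp add: nf_def)

text \<open>A word with a bad factor is bad. Replacing a bad factor by ones therefore keeps the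
  concatenation bad and of the same length, which makes concatenation of normal forms
  associative.\<close>

lemma nf_append_nf:
  "nf X (nf X u @ v) = nf X (u @ v)" "nf X (u @ nf X v) = nf X (u @ v)"
proof -
  show "nf X (nf X u @ v) = nf X (u @ v)"
  proof (cases "sparse X u")
    case False
    then have "\<not> sparse X (u @ v)" "\<not> sparse X (replicate (length u) True @ v)"
      using sparse_appendD(1) sparse_replicate_True by blast+
    then show ?thesis using False by (simp add: nf_def)
  qed (simp add: nf_def)
  show "nf X (u @ nf X v) = nf X (u @ v)"
  proof (cases "sparse X v")
    case False
    then have "\<not> sparse X (u @ v)" "\<not> sparse X (u @ replicate (length v) True)"
      using sparse_appendD(2) sparse_replicate_True by blast+
    then show ?thesis using False by (simp add: nf_def)
  qed (simp add: nf_def)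
qed

lemma nf_idem [simp]: "nf X (nf X w) = nf X w"
  using nf_append_nf(1)[of X w "[]"] by simp

lemma card_bool_lists: "card {w :: bool list. length w = n} = 2 ^ n"
  using card_lists_length_eq[of "UNIV :: bool set" n] by (simp add: card_UNIV_bool)

lemma finite_bool_lists [simp]: "finite {w :: bool list. length w = n}"
  using finite_lists_length_eq[of "UNIV :: bool set" n] by simp

text \<open>If all ones sit at multiples of \<open>p\<close>, their differences are multiples of
  \<open>p\<close> and hence allowed. This leaves \<open>n div p\<close> free bits.\<close>

lemma card_sparse_ge:
  assumes "\<And>\<delta>. p dvd \<delta> \<Longrightarrow> 0 < \<delta> \<Longrightarrow> \<delta> < n \<Longrightarrow> \<delta> \<notin> X" "p > 0"
  shows "2 ^ (n div p) \<le> card {w. sparse X w \<and> length w = n}"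
proof -
  define q where "q = n div p"
  \<comment> \<open>If \<open>p\<close> does not divide \<open>n\<close>, the multiple
    \<open>p * q\<close> is also a position; the guard \<open>i div p < q\<close> puts a zero there
    and keeps \<open>us\<close> from being read beyond its end.\<close>
  define h where "h us = map (\<lambda>i. p dvd i \<and> i div p < q \<and> us ! (i div p)) [0..<n]" for us :: "bool list"
  have lt: "p * i < n" if "i < q" for i
  proof -
    have "p * Suc i \<le> p * q" using that by (intro mult_le_mono) auto
    also have "\<dots> \<le> n" by (simp add: q_def)
    finally show ?thesis using assms(2) by simp
  qed
  have "inj_on h {us. length us = q}"
  proof (rule inj_onI)
    fix us vs assume *: "us \<in> {us. length us = q}" "vs \<in> {us. length us = q}" "h us = h vs"
    show "us = vs"
    proof (rule nth_equalityI)
      fix i assume "i < length us"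
      then have i: "i < q" using * by simp
      have "h us ! (p * i) = h vs ! (p * i)" using * by simp
      then show "us ! i = vs ! i" using lt[OF i] i assms(2) by (simp add: h_def)
    qed (use * in simp)
  qed
  moreover have "h ` {us. length us = q} \<subseteq> {w. sparse X w \<and> length w = n}"
  proof (clarify, intro conjI)
    fix us show "sparse X (h us)"
      unfolding sparse_def
    proof (intro allI impI)
      fix j i assume "j < length (h us)" "i < j" "h us ! i" "h us ! j"
      then show "j - i \<notin> X" by (intro assms(1)) (auto simp: h_def)
    qed
    show "length (h us) = n" by (simp add: h_def)
  qed
  moreover have "finite {w. sparse X w \<and> length w = n}"
    by (rule finite_subset[OF _ finite_bool_lists[of n]]) auto
  ultimately have "card {us :: bool list. length us = q} \<le> card {w. sparse X w \<and> length w = n}"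
    by (intro card_inj_on_le)
  then show ?thesis by (simp add: card_bool_lists q_def)
qed

lemma card_insert_le_Suc: "card (insert x B) \<le> Suc (card B)"
  by (cases "finite B") (simp_all add: card_insert_if)

text \<open>In a sparse word of length at most \<open>N\<close> two ones are at most
  \<open>D\<close> apart, so all ones lie in a window of length \<open>D + 1\<close> that starts at
  the first one. The word is determined by where the window starts and what it contains; the word of
  ones is added for the bad class.\<close>

lemma card_normal_words_le:
  assumes "{D<..N} \<subseteq> X" "m \<le> N"
  shows "card {w. w \<noteq> [] \<and> nf X w = w \<and> length w = m} \<le> 2 ^ (D + 4) * m"
proof (cases "m = 0")
  case True
  then have "{w. w \<noteq> [] \<and> nf X w = w \<and> length w = m} = {}" by auto
  then show ?thesis by (simp only: card.empty)
next
  case False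
  let ?U = "{u :: bool list. set u \<subseteq> UNIV \<and> length u \<le> D + 1}"
  define h where "h = (\<lambda>(i, u). replicate i False @ u @ replicate (m - i - length u) False)"
  have "{w. w \<noteq> [] \<and> nf X w = w \<and> length w = m} \<subseteq> insert (replicate m True) (h ` ({..m} \<times> ?U))"
  proof
    fix w assume "w \<in> {w. w \<noteq> [] \<and> nf X w = w \<and> length w = m}"
    then have w: "length w = m" "w = replicate m True \<or> sparse X w"
      by (auto simp: nf_def split: if_splits)
    show "w \<in> insert (replicate m True) (h ` ({..m} \<times> ?U))"
    proof (cases "w = replicate m True")
      case False
      then have sparse: "sparse X w" using w by blast
      define z v where "z = takeWhile Not w" and "v = dropWhile Not w"
      have zv: "w = z @ v" by (simp add: z_def v_def)
      have z: "z = replicate (length z) False"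
        by (rule replicate_length_same[symmetric]) (auto simp: z_def dest: set_takeWhileD)
      \<comment> \<open>The first one of \<open>w\<close> is \<open>v ! 0\<close>. A one more than
        \<open>D\<close> places later would give a difference above \<open>D\<close> and, as
        \<open>w\<close> has length at most \<open>N\<close>, inside \<open>{D<..N}\<close>.\<close>
      have "drop (D + 1) v = replicate (length v - (D + 1)) False"
      proof (rule nth_equalityI)
        fix i assume "i < length (drop (D + 1) v)"
        then have i: "D + 1 + i < length v" by simp
        then have "v \<noteq> []" by auto
        then have "v ! 0" using hd_dropWhile[of Not w] by (simp add: v_def hd_conv_nth)
        have "\<not> v ! (D + 1 + i)"
        proof
          assume "v ! (D + 1 + i)"
          then have "(length z + (D + 1 + i)) - length z \<notin> X"
            using sparse[unfolded sparse_def, rule_format, of "length z + (D + 1 + i)" "length z"]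
              \<open>v ! 0\<close> i by (simp add: zv nth_append)
          moreover have "D + 1 + i \<in> X"
            using i w assms by (intro subsetD[OF assms(1)]) (auto simp: zv)
          ultimately show False by simp
        qed
        then show "drop (D + 1) v ! i = replicate (length v - (D + 1)) False ! i"
          using i by simp
      qed simp
      then have v: "v = take (D + 1) v @ replicate (length v - (D + 1)) False"
        by (metis append_take_drop_id)
      have "w = h (length z, take (D + 1) v)"
        using w(1) z v by (auto simp: h_def zv min_def)
      moreover have "(length z, take (D + 1) v) \<in> {..m} \<times> ?U"
        using w(1) by (auto simp: zv)
      ultimately show ?thesis by blast
    qed simp
  qed
  moreover have fin: "finite ?U" by (rule finite_lists_length_le) simp
  ultimately have "card {w. w \<noteq> [] \<and> nf X w = w \<and> length w = m}
      \<le> card (insert (replicate m True) (h ` ({..m} \<times> ?U)))"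
    by (intro card_mono) auto
  also have "\<dots> \<le> Suc (card ({..m} \<times> ?U))"
    using card_image_le[of "{..m} \<times> ?U" h] fin
    by (intro order_trans[OF card_insert_le_Suc]) auto
  also have "card ({..m} \<times> ?U) = (m + 1) * card ?U"
    by (simp add: card_cartesian_product)
  finally have "card {w. w \<noteq> [] \<and> nf X w = w \<and> length w = m} \<le> Suc ((m + 1) * card ?U)" .
  moreover have "card ?U \<le> 2 ^ (D + 2)"
  proof -
    have "card ?U = (\<Sum>i\<le>D + 1. 2 ^ i)"
      using card_lists_length_le[of "UNIV :: bool set" "D + 1"] by (simp add: card_UNIV_bool)
    also have "\<dots> < 2 ^ (D + 2)"
      using sum_power2[of "D + 2"] by (simp add: lessThan_Suc_atMost[symmetric] atLeast0LessThan)
    finally show ?thesis by simp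
  qed
  ultimately have "card {w. w \<noteq> [] \<and> nf X w = w \<and> length w = m} \<le> Suc ((m + 1) * 2 ^ (D + 2))"
    by (meson Suc_le_mono le_trans mult_le_mono2)
  also have "\<dots> \<le> 2 ^ (D + 4) * m"
  proof -
    obtain k where m: "m = Suc k" using False by (cases m) auto
    have "(1::nat) \<le> 2 ^ D" by simp
    then have "1 \<le> 8 * 2 ^ D + k * (12 * 2 ^ D)" by (intro trans_le_add1) simp
    then show ?thesis unfolding m power_add by (simp add: algebra_simps)
  qed
  finally show ?thesis .
qed

section \<open>Choice of the forbidden set\<close>

lemma subexponential_le_power2:
  assumes "subexponential f" "p > 0"
  shows "eventually (\<lambda>n. f n \<le> 2 ^ (n div p)) at_top"
proof -
  \<comment> \<open>The limsup is 1, so \<open>f n\<close> is eventually at most the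
    \<open>n\<close>-th power of any base above 1. The factor 2 in the exponent absorbs the rounding
    in \<open>n div p\<close>.\<close>
  define c :: real where "c = 2 powr (1 / (2 * real p))"
  have "c > 1" using assms(2) by (simp add: c_def)
  have "limsup (\<lambda>n. ereal (root n (real (f n)))) < ereal c"
    using assms(1) \<open>c > 1\<close> by (simp add: subexponential_def one_ereal_def)
  then have "eventually (\<lambda>n. ereal (root n (real (f n))) < ereal c) at_top"
    by (rule Limsup_lessD)
  moreover have "eventually (\<lambda>n. n \<ge> 2 * p) at_top" by (rule eventually_ge_at_top)
  ultimately show ?thesis
  proof eventually_elim
    case (elim n)
    then have n: "n > 0" using assms(2) by simp
    have "real (f n) = root n (real (f n)) ^ n" using n by simp
    also have "\<dots> \<le> c ^ n" using elim n by (intro power_mono) auto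
    also have "\<dots> = 2 powr (real n / (2 * real p))"
      by (simp add: c_def powr_realpow[symmetric] powr_powr)
    also have "\<dots> \<le> 2 powr real (n div p)"
    proof -
      have "n = p * (n div p) + n mod p" by simp
      moreover have "n mod p < p" using assms(2) by simp
      moreover have "2 \<le> n div p" using elim(2) assms(2) by (simp add: less_eq_div_iff_mult_less_eq)
      then have "p * 2 \<le> p * (n div p)" by simp
      ultimately have "n \<le> 2 * p * (n div p)" by linarith
      then have "real n \<le> 2 * real p * real (n div p)"
        by (metis of_nat_le_iff of_nat_mult of_nat_numeral)
      then show ?thesis using assms(2) by (simp add: field_simps)
    qed
    also have "\<dots> = real (2 ^ (n div p))" by (simp add: powr_realpow)
    finally show ?case by linarith
  qed
qed

text \<open>Thresholds \<open>N 0 < D 0 < N 1 < D 1 < ...\<close> are chosen alternately, each large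
  compared with the one before. The gap up to \<open>D k\<close> makes many words of length
  \<open>D k\<close> sparse, and the forbidden interval from \<open>D k\<close> to
  \<open>N (Suc k)\<close> leaves few normal words of length up to \<open>N (Suc k)\<close>.\<close>

lemma exists_oscillating_set:
  assumes "subexponential f"
  obtains X where "\<exists>\<^sub>\<infinity>n. f n \<le> card {w. sparse X w \<and> length w = n}"
    and "\<exists>\<^sub>\<infinity>t. \<exists>C. (\<forall>m\<le>t ^ 3. card {w. w \<noteq> [] \<and> nf X w = w \<and> length w = m} \<le> C * m)
      \<and> real ((t ^ 3 + 1) ^ (C * t ^ 2) * (C * t ^ 6 + 1) ^ (t ^ 2)) \<le> exp (real t powr (9/4))"
proof -
  have "\<exists>D. N < D \<and> f D \<le> 2 ^ (D div (N + 1))" for N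
  proof -
    have "eventually (\<lambda>D. N < D \<and> f D \<le> 2 ^ (D div (N + 1))) at_top"
      by (intro eventually_conj eventually_gt_at_top subexponential_le_power2 assms) simp
    then show ?thesis by (rule eventually_happens'[OF sequentially_bot])
  qed
  then obtain d where d: "\<And>N. N < d N" "\<And>N. f (d N) \<le> 2 ^ (d N div (N + 1))" by metis
  \<comment> \<open>The constant \<open>2 ^ (D + 4)\<close> is the one from
    \<open>card_normal_words_le\<close>; it is fixed before \<open>t\<close> is chosen, so the bound
    holds for large \<open>t\<close>.\<close>
  define good where "good D t \<longleftrightarrow> (let C = 2 ^ (D + 4) in
      real ((t ^ 3 + 1) ^ (C * t ^ 2) * (C * t ^ 6 + 1) ^ (t ^ 2)) \<le> exp (real t powr (9/4)))"
    for D t :: nat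
  have "\<exists>t. D < t \<and> good D t" for D
  proof -
    have "eventually (\<lambda>t. D < t \<and> good D t) at_top"
      unfolding good_def Let_def
      by (intro eventually_conj eventually_gt_at_top eventually_count_bound) simp
    then show ?thesis by (rule eventually_happens'[OF sequentially_bot])
  qed
  then obtain \<tau> where \<tau>: "\<And>D. D < \<tau> D" "\<And>D. good D (\<tau> D)" by metis
  define N where "N = rec_nat 0 (\<lambda>_ n. \<tau> (d n) ^ 3)"
  define D where "D k = d (N k)" for k
  define t where "t k = \<tau> (D k)" for k
  have N_Suc: "N (Suc k) = t k ^ 3" for k by (simp add: N_def t_def D_def)
  have le_cube: "x \<le> x ^ 3" for x :: nat by (cases x) (auto simp: power3_eq_cube)
  have ND: "N k < D k" and DN: "D k < N (Suc k)" and Dt: "D k < t k" for k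
  proof -
    show "N k < D k" "D k < t k" using d \<tau> by (simp_all add: D_def t_def)
    then show "D k < N (Suc k)" unfolding N_Suc using le_cube[of "t k"] by linarith
  qed
  have N_mono: "mono N"
  proof (rule incseq_SucI)
    show "N k \<le> N (Suc k)" for k using ND[of k] DN[of k] by linarith
  qed
  have D_mono: "mono D"
  proof (rule incseq_SucI)
    show "D k \<le> D (Suc k)" for k using DN[of k] ND[of "Suc k"] by linarith
  qed
  have k_le: "k \<le> D k" for k
  proof (induction k)
    case (Suc k)
    then show ?case using DN[of k] ND[of "Suc k"] by linarith
  qed simp
  define X where "X = (\<Union>k. {D k<..N (Suc k)})"
  show thesis
  proof (rule that)
    have "f (D k) \<le> card {w. sparse X w \<and> length w = D k}" for k
    proof -
      \<comment> \<open>Positive multiples of \<open>N k + 1\<close> exceed \<open>N k\<close>,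
        where the intervals of index below \<open>k\<close> have ended. Those below
        \<open>D k\<close> lie before all intervals of index at least \<open>k\<close>.\<close>
      have "\<delta> \<notin> X" if "(N k + 1) dvd \<delta>" "0 < \<delta>" "\<delta> < D k" for \<delta>
      proof
        assume "\<delta> \<in> X"
        then obtain j where j: "D j < \<delta>" "\<delta> \<le> N (Suc j)" by (auto simp: X_def)
        have "N k < \<delta>" using dvd_imp_le[OF that(1,2)] by simp
        show False
        proof (cases "Suc j \<le> k")
          case True
          then show ?thesis using monoD[OF N_mono True] j \<open>N k < \<delta>\<close> by linarith
        next
          case False
          then show ?thesis using monoD[OF D_mono, of k j] j that(3) by simp
        qed
      qed
      then have "2 ^ (D k div (N k + 1)) \<le> card {w. sparse X w \<and> length w = D k}"
        by (intro card_sparse_ge) auto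
      then show ?thesis using d(2)[of "N k"] unfolding D_def by linarith
    qed
    then show "\<exists>\<^sub>\<infinity>n. f n \<le> card {w. sparse X w \<and> length w = n}"
      unfolding INFM_nat_le using k_le by blast
    have "\<exists>C. (\<forall>m\<le>t k ^ 3. card {w. w \<noteq> [] \<and> nf X w = w \<and> length w = m} \<le> C * m)
      \<and> real ((t k ^ 3 + 1) ^ (C * t k ^ 2) * (C * t k ^ 6 + 1) ^ (t k ^ 2)) \<le> exp (real (t k) powr (9/4))" for k
    proof (intro exI[of _ "2 ^ (D k + 4)"] conjI allI impI)
      fix m assume "m \<le> t k ^ 3"
      then show "card {w. w \<noteq> [] \<and> nf X w = w \<and> length w = m} \<le> 2 ^ (D k + 4) * m"
        by (intro card_normal_words_le[of _ "N (Suc k)"]) (auto simp: X_def N_Suc)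
    qed (use \<tau>(2)[of "D k"] in \<open>simp only: good_def Let_def t_def\<close>)
    moreover have "k \<le> t k" for k using k_le[of k] Dt[of k] by linarith
    ultimately show "\<exists>\<^sub>\<infinity>t. \<exists>C. (\<forall>m\<le>t ^ 3. card {w. w \<noteq> [] \<and> nf X w = w \<and> length w = m} \<le> C * m)
      \<and> real ((t ^ 3 + 1) ^ (C * t ^ 2) * (C * t ^ 6 + 1) ^ (t ^ 2)) \<le> exp (real t powr (9/4))"
      unfolding INFM_nat_le by blast
  qed
qed

section \<open>The domain attached to a set of forbidden differences\<close>


definition word_op :: "nat set \<Rightarrow> nat \<Rightarrow> nat \<Rightarrow> nat"
  where "word_op X m n = to_nat (nf X (from_nat m @ from_nat n))"

definition wlen :: "nat \<Rightarrow> nat"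
  where "wlen m = length (from_nat m :: bool list)"

text \<open>The empty word is left out so that every code has positive length; otherwise infinitely
  many multisets would share a weight.\<close>

definition codes :: "nat set \<Rightarrow> nat set"
  where "codes X = to_nat ` {w :: bool list. w \<noteq> [] \<and> nf X w = w}"

text \<open>Sorted lists represent multisets uniquely, so the algebra can live on functions on
  \<open>nat list\<close>. The order of the codes also supplies the linear order behind
  \<open>nprod_unique_product\<close>.\<close>

definition basis :: "nat set \<Rightarrow> nat list set"
  where "basis X = {xs. sorted xs \<and> set xs \<subseteq> codes X}"

definition coef :: "nat set \<Rightarrow> nat list \<Rightarrow> nat list \<Rightarrow> nat list \<Rightarrow> int"
  where "coef X i j k = Poly_Mapping.lookup (semigroup.nprod (word_op X) (mset i) (mset j)) (mset k)"

definition weight :: "nat list \<Rightarrow> nat"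
  where "weight xs = (\<Sum>x\<in>#mset xs. wlen x)"

text \<open>As \<open>from_nat\<close> is total, the operation is associative on all natural
  numbers; \<open>codes X\<close> is a subset closed under it.\<close>

lemma semigroup_word_op: "semigroup (word_op X)"
  by standard (simp add: word_op_def nf_append_nf)

lemma wlen_word_op: "wlen (word_op X m n) = wlen m + wlen n"
  by (simp add: wlen_def word_op_def)

lemma word_op_codes:
  assumes "m \<in> codes X" "n \<in> codes X"
  shows "word_op X m n \<in> codes X"
proof -
  obtain u v :: "bool list" where uv: "m = to_nat u" "n = to_nat v" "u \<noteq> []"
    using assms unfolding codes_def by (elim imageE CollectE) simp
  have "nf X (u @ v) \<noteq> []"
    using uv(3) length_nf[of X "u @ v"] by (metis append_is_Nil_conv length_0_conv)
  then show ?thesis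
    unfolding codes_def word_op_def uv(1,2) from_nat_to_nat by (intro imageI) simp
qed

lemma wlen_codes: "x \<in> codes X \<Longrightarrow> 0 < wlen x"
  by (auto simp: codes_def wlen_def)

lemma finite_codes_wlen: "finite {x\<in>codes X. wlen x \<le> n}"
proof (rule finite_subset)
  show "{x\<in>codes X. wlen x \<le> n} \<subseteq> to_nat ` {w :: bool list. set w \<subseteq> UNIV \<and> length w \<le> n}"
    by (auto simp: codes_def wlen_def)
  show "finite (to_nat ` {w :: bool list. set w \<subseteq> UNIV \<and> length w \<le> n})"
    by (intro finite_imageI finite_lists_length_le) simp
qed

lemma bij_basis: "bij_betw mset (basis X) {\<mu>. set_mset \<mu> \<subseteq> codes X}"
proof (rule bij_betwI[where g = sorted_list_of_multiset])
  show "sorted_list_of_multiset (mset xs) = xs" if "xs \<in> basis X" for xs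
    using that by (simp add: basis_def sorted_list_of_multiset_mset sorted_sort_id)
qed (auto simp: basis_def)

lemma weight_le_finite: "finite {xs\<in>basis X. weight xs \<le> n}"
proof (rule finite_subset)
  let ?B = "{x\<in>codes X. wlen x \<le> n}"
  show "{xs\<in>basis X. weight xs \<le> n} \<subseteq> {xs. set xs \<subseteq> ?B \<and> length xs \<le> n}"
  proof clarify
    fix xs assume xs: "xs \<in> basis X" "weight xs \<le> n"
    have "set xs \<subseteq> codes X" using xs by (simp add: basis_def)
    then have "length xs \<le> weight xs \<and> (\<forall>x\<in>set xs. wlen x \<le> weight xs)"
    proof (induction xs)
      case (Cons x xs)
      then show ?case using wlen_codes[of x X] by (fastforce simp: weight_def)
    qed (simp add: weight_def)
    then show "set xs \<subseteq> ?B \<and> length xs \<le> n"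
      using xs by (fastforce simp: basis_def)
  qed
  show "finite {xs. set xs \<subseteq> ?B \<and> length xs \<le> n}"
    by (rule finite_lists_length_le[OF finite_codes_wlen])
qed

lemma lookup_frag_extend:
  "Poly_Mapping.lookup (frag_extend f p) x
    = (\<Sum>\<mu>\<in>Poly_Mapping.keys p. Poly_Mapping.lookup p \<mu> * Poly_Mapping.lookup (f \<mu>) x)"
  by (simp add: frag_extend_def lookup_sum)

text \<open>Coefficients of \<open>star\<close> are sums over the support of a polynomial, while
  \<open>c_assoc\<close> sums over basis lists of bounded weight. Under the two conditions each
  nonzero term appears on both sides.\<close>

lemma sum_keys_basis:
  fixes p :: "nat multiset \<Rightarrow>\<^sub>0 int" and g :: "nat multiset \<Rightarrow> int"
  assumes "\<And>\<mu>. \<mu> \<in> Poly_Mapping.keys p \<Longrightarrow> set_mset \<mu> \<subseteq> codes X"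
    and "\<And>\<mu>. \<mu> \<in> Poly_Mapping.keys p \<Longrightarrow> g \<mu> \<noteq> 0 \<Longrightarrow> (\<Sum>x\<in>#\<mu>. wlen x) \<le> N"
  shows "(\<Sum>\<mu>\<in>Poly_Mapping.keys p. Poly_Mapping.lookup p \<mu> * g \<mu>)
    = (\<Sum>k | k \<in> basis X \<and> weight k \<le> N. Poly_Mapping.lookup p (mset k) * g (mset k))"
proof -
  let ?K = "{k. k \<in> basis X \<and> weight k \<le> N}"
  have fin: "finite ?K" by (rule weight_le_finite)
  have inj: "inj_on mset ?K"
    using bij_betw_imp_inj_on[OF bij_basis] by (rule inj_on_subset) auto
  have "(\<Sum>k\<in>?K. Poly_Mapping.lookup p (mset k) * g (mset k))
      = (\<Sum>\<mu>\<in>mset ` ?K. Poly_Mapping.lookup p \<mu> * g \<mu>)"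
    by (simp add: sum.reindex[OF inj])
  also have "\<dots> = (\<Sum>\<mu>\<in>Poly_Mapping.keys p. Poly_Mapping.lookup p \<mu> * g \<mu>)"
  proof (rule sum.mono_neutral_cong)
    fix \<mu> assume \<mu>: "\<mu> \<in> Poly_Mapping.keys p - mset ` ?K"
    show "Poly_Mapping.lookup p \<mu> * g \<mu> = 0"
    proof (rule ccontr)
      assume "Poly_Mapping.lookup p \<mu> * g \<mu> \<noteq> 0"
      then have "g \<mu> \<noteq> 0" by auto
      then have "set_mset \<mu> \<subseteq> codes X" "(\<Sum>x\<in>#\<mu>. wlen x) \<le> N"
        using assms(1)[of \<mu>] assms(2)[of \<mu>] \<mu> by blast+
      moreover from this obtain k where "k \<in> basis X" "mset k = \<mu>"
        using bij_betw_imp_surj_on[OF bij_basis, of X] by (metis (mono_tags) imageE mem_Collect_eq)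
      ultimately show False using \<mu> by (auto simp: weight_def)
    qed
  qed (use fin in \<open>auto simp: in_keys_iff\<close>)
  finally show ?thesis by simp
qed

lemma structure_constants:
  assumes "field F"
  shows "graded_structure_constants F (basis X) (coef X) [] weight"
proof -
  interpret semigroup "word_op X" by (rule semigroup_word_op)
  have mset_eq: "mset j = mset k \<longleftrightarrow> j = k" if "j \<in> basis X" "k \<in> basis X" for j k
    using inj_on_eq_iff[OF bij_betw_imp_inj_on[OF bij_basis] that] .
  have sub: "set_mset (mset i) \<subseteq> codes X" if "i \<in> basis X" for i
    using that by (simp add: basis_def)
  have keys_sub: "set_mset \<kappa> \<subseteq> codes X"
    if "\<kappa> \<in> Poly_Mapping.keys (nprod \<mu> \<nu>)" "set_mset \<mu> \<subseteq> codes X" "set_mset \<nu> \<subseteq> codes X" for \<kappa> \<mu> \<nu>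
    using set_mset_of_keys_nprod[of "codes X", OF word_op_codes that(1)] that by blast
  note keys_weight = weight_of_keys_nprod[of wlen, OF wlen_word_op]
  have "graded_structure_constants_axioms (basis X) (coef X) [] weight"
  proof
    show "finite {i \<in> basis X. weight i \<le> N}" for N by (rule weight_le_finite)
    show "[] \<in> basis X" by (simp add: basis_def)
    show "coef X [] j k = (if j = k then 1 else 0)" "coef X j [] k = (if j = k then 1 else 0)"
      if "j \<in> basis X" "k \<in> basis X" for j k
      using mset_eq[OF that] by (auto simp: coef_def)
    show "weight k = weight i + weight j"
      if "i \<in> basis X" "j \<in> basis X" "k \<in> basis X" "coef X i j k \<noteq> 0" for i j k
      using that keys_weight[of "mset k" "mset i" "mset j"] by (simp add: coef_def weight_def in_keys_iff)
    show "(\<Sum>k | k \<in> basis X \<and> weight k \<le> weight n. coef X i j k * coef X k l n)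
        = (\<Sum>k | k \<in> basis X \<and> weight k \<le> weight n. coef X j l k * coef X i k n)"
      if "i \<in> basis X" "j \<in> basis X" "l \<in> basis X" "n \<in> basis X" for i j l n
    proof -
      \<comment> \<open>Both cut-off sums are coefficients at \<open>mset n\<close> of triple
        products, so the identity is \<open>star_assoc\<close> read at one coefficient. Weights add
        under \<open>nprod\<close>, which justifies the cutoff.\<close>
      have "(\<Sum>k | k \<in> basis X \<and> weight k \<le> weight n. coef X i j k * coef X k l n)
          = Poly_Mapping.lookup (star (nprod (mset i) (mset j)) (frag_of (mset l))) (mset n)"
        unfolding coef_def star_def lookup_frag_extend frag_extend_of
        using that keys_sub sub
        by (intro sum_keys_basis[symmetric]) (auto simp: weight_def in_keys_iff[symmetric] dest!: keys_weight)
      also have "\<dots> = Poly_Mapping.lookup (star (frag_of (mset i)) (nprod (mset j) (mset l))) (mset n)"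
        using star_assoc[of "frag_of (mset i)" "frag_of (mset j)" "frag_of (mset l)"]
        by (simp only: star_frag_of)
      also have "\<dots> = (\<Sum>k | k \<in> basis X \<and> weight k \<le> weight n. coef X j l k * coef X i k n)"
        unfolding coef_def star_def lookup_frag_extend frag_extend_of
        using that keys_sub sub
        by (intro sum_keys_basis) (auto simp: weight_def in_keys_iff[symmetric] dest!: keys_weight)
      finally show ?thesis .
    qed
    show "\<exists>i\<in>A. \<exists>j\<in>B. \<exists>k\<in>basis X. coef X i j k = 1 \<and>
        (\<forall>i'\<in>A. \<forall>j'\<in>B. coef X i' j' k \<noteq> 0 \<longrightarrow> i' = i \<and> j' = j)"
      if A: "finite A" "A \<subseteq> basis X" "A \<noteq> {}" and B: "finite B" "B \<subseteq> basis X" "B \<noteq> {}" for A B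
    proof -
      obtain \<mu> \<nu> where \<mu>: "\<mu> \<in> mset ` A" and \<nu>: "\<nu> \<in> mset ` B"
        and uniq: "\<And>\<mu>' \<nu>'. \<mu>' \<in> mset ` A \<Longrightarrow> \<nu>' \<in> mset ` B \<Longrightarrow>
          \<mu> + \<nu> \<in> Poly_Mapping.keys (nprod \<mu>' \<nu>') \<Longrightarrow> \<mu>' = \<mu> \<and> \<nu>' = \<nu>"
        using nprod_unique_product[OF semigroup_axioms, of "mset ` A" "mset ` B"] A B by auto
      obtain i j where ij: "i \<in> A" "\<mu> = mset i" "j \<in> B" "\<nu> = mset j" using \<mu> \<nu> by auto
      then have ijI: "i \<in> basis X" "j \<in> basis X" using A B by auto
      define k where "k = sorted_list_of_multiset (\<mu> + \<nu>)"
      have k: "k \<in> basis X" "mset k = \<mu> + \<nu>"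
        using sub[OF ijI(1)] sub[OF ijI(2)] ij by (auto simp: k_def basis_def)
      have "i' = i \<and> j' = j" if i': "i' \<in> A" and j': "j' \<in> B" and "coef X i' j' k \<noteq> 0" for i' j'
      proof -
        have "mset i' = mset i \<and> mset j' = mset j"
          using uniq[OF imageI[OF i'] imageI[OF j']] that(3) k ij by (simp add: coef_def in_keys_iff)
        then show ?thesis using mset_eq ijI i' j' A B by blast
      qed
      moreover have "coef X i j k = 1" using ij k lookup_nprod_top by (simp add: coef_def)
      ultimately show ?thesis using ij k by blast
    qed
  qed
  then show ?thesis
    using assms by (intro graded_structure_constants.intro)
qed

text \<open>The letters are the two words of length one, and singleton multisets play the part of
  \<open>T\<close>. A product of letters projects to the normal form of the word they spell; a
  sparse word is its own normal form, so different sparse words of length \<open>n\<close> give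
  different elements to be counted by \<open>growth_ge\<close>.\<close>

theorem exists_domain_of_sparse_words:
  fixes F :: "('f, 'm) ring_scheme"
  assumes F: "field F"
  obtains A :: "('f, nat list \<Rightarrow> 'f) module" and V
  where "assoc_algebra F A" "noncomm_domain A" "fin_dim_generating_subspace F A V"
    and "\<And>n. 0 < n \<Longrightarrow> card {w. sparse X w \<and> length w = n} \<le> growth F A V n"
    and "\<And>n. growth F A V n \<le> card {\<mu>. set_mset \<mu> \<subseteq> codes X \<and> (\<Sum>x\<in>#\<mu>. wlen x) \<le> n}"
proof -
  interpret graded_structure_constants F "basis X" "coef X" "[]" weight
    by (rule structure_constants[OF F])
  interpret W: semigroup "word_op X" by (rule semigroup_word_op)
  define letter :: "bool \<Rightarrow> nat list" where "letter b = [to_nat [b]]" for b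
  define L where "L = range letter"
  define T where "T = (\<lambda>x. [x]) ` codes X"
  define op where "op l b = [word_op X (hd l) (hd b)]" for l b
  have letter_codes: "to_nat [b] \<in> codes X" for b :: bool
    \<comment> \<open>A word of length one has no two positions and so is sparse for every
      \<open>X\<close>.\<close>
    unfolding codes_def by (intro imageI) (simp add: nf_def sparse_def)
  have L: "L \<subseteq> basis X" "finite L" "\<And>b. b \<in> L \<Longrightarrow> weight b = 1"
    using letter_codes by (auto simp: L_def letter_def basis_def weight_def wlen_def)
  have T: "T \<subseteq> basis X" "L \<subseteq> T" "[] \<notin> T"
    using letter_codes by (auto simp: T_def basis_def L_def letter_def)
  have op: "op l b \<in> T" if "l \<in> T" "b \<in> L" for l b
    using that T(2) word_op_codes by (auto simp: T_def op_def)
  have c_T: "coef X l b t = (if l = [] \<and> b = t \<or> l \<in> T \<and> op l b = t then 1 else 0)"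
    if l: "l \<in> basis X" and b: "b \<in> L" and t: "t \<in> T" for l b t
  proof -
    obtain x y where xy: "b = [x]" "t = [y]" using b t by (auto simp: L_def letter_def T_def)
    have "(\<exists>a. mset l = {#a#} \<and> word_op X a x = y) \<longleftrightarrow> l \<in> T \<and> op l b = t"
      using l by (auto simp: xy op_def T_def basis_def mset_single_iff)
    then show ?thesis by (simp add: coef_def xy W.lookup_nprod_single_single)
  qed
  let ?V = "supported L"
  let ?A = "S.gen_alg ?V"
  show thesis
  proof (rule that[of ?A ?V])
    show "assoc_algebra F ?A" by (rule S.gen_alg(2)[OF submodule_supported])
    show "noncomm_domain ?A" by (rule S.gen_alg(5)[OF submodule_supported noncomm_domain_salg])
    show "fin_dim_generating_subspace F ?A ?V" by (rule fin_dim_generating_supported[OF L])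
    fix n
    have "growth F ?A ?V n \<le> card (below n)" by (rule growth_generated(1)[OF L])
    also have "\<dots> = card (mset ` below n)"
    proof (rule card_image[symmetric])
      have "below n \<subseteq> basis X" by (auto simp: below_def)
      then show "inj_on mset (below n)"
        using bij_betw_imp_inj_on[OF bij_basis] inj_on_subset by blast
    qed
    also have "mset ` below n = {\<mu> \<in> mset ` basis X. (\<Sum>x\<in>#\<mu>. wlen x) \<le> n}"
      by (auto simp: below_def weight_def)
    also have "\<dots> = {\<mu>. set_mset \<mu> \<subseteq> codes X \<and> (\<Sum>x\<in>#\<mu>. wlen x) \<le> n}"
      unfolding bij_betw_imp_surj_on[OF bij_basis] by simp
    finally show "growth F ?A ?V n \<le> card {\<mu>. set_mset \<mu> \<subseteq> codes X \<and> (\<Sum>x\<in>#\<mu>. wlen x) \<le> n}" .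
    assume n: "0 < n"
    let ?C = "{t\<in>T. \<exists>b bs. b \<in> L \<and> set bs \<subseteq> L \<and> Suc (length bs) = n \<and> foldl op b bs = t}"
    have foldl: "foldl op (letter b) (map letter bs) = [to_nat (nf X (b # bs))]" for b bs
    proof (induction bs rule: rev_induct)
      case Nil
      then show ?case by (simp add: letter_def nf_def sparse_def)
    next
      case (snoc d bs)
      then show ?case
        using nf_append_nf(1)[of X "b # bs" "[d]"] by (simp add: op_def letter_def word_op_def)
    qed
    have sub: "(\<lambda>w. [to_nat w]) ` {w. sparse X w \<and> length w = n} \<subseteq> ?C"
    proof (clarify, intro conjI)
      fix w assume w: "sparse X w" "n = length w"
      then obtain b bs where bs: "w = b # bs" using n by (cases w) auto
      have "nf X w = w" using w by (simp add: nf_def)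
      then show "[to_nat w] \<in> T" using bs unfolding T_def codes_def by (intro imageI) simp
      show "\<exists>b bs. b \<in> L \<and> set bs \<subseteq> L \<and> Suc (length bs) = length w \<and> foldl op b bs = [to_nat w]"
        using foldl[of b bs] bs \<open>nf X w = w\<close>
        by (intro exI[of _ "letter b"] exI[of _ "map letter bs"]) (auto simp: L_def)
    qed
    have fin: "finite ?C"
    proof (rule finite_subset)
      show "?C \<subseteq> (\<lambda>(b, bs). foldl op b bs) ` (L \<times> {bs. set bs \<subseteq> L \<and> length bs = n - 1})"
      proof clarify
        fix b bs assume "b \<in> L" "set bs \<subseteq> L" "n = Suc (length bs)"
        then show "foldl op b bs \<in> (\<lambda>(b, bs). foldl op b bs) `
            (L \<times> {bs'. set bs' \<subseteq> L \<and> length bs' = Suc (length bs) - 1})"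
          by (intro image_eqI[of _ _ "(b, bs)"]) simp_all
      qed
      show "finite ((\<lambda>(b, bs). foldl op b bs) ` (L \<times> {bs. set bs \<subseteq> L \<and> length bs = n - 1}))"
        using L(2) by (intro finite_imageI finite_cartesian_product finite_lists_length_eq)
    qed
    have "inj_on (\<lambda>w. [to_nat w]) {w. sparse X w \<and> length w = n}"
      by (auto simp: inj_on_def)
    then have "card {w. sparse X w \<and> length w = n} \<le> card ?C"
      by (rule card_inj_on_le[OF _ sub fin])
    also have "\<dots> \<le> growth F ?A ?V n"
      by (rule growth_ge[OF L T op c_T])
    finally show "card {w. sparse X w \<and> length w = n} \<le> growth F ?A ?V n" .
  qed
qed

section \<open>Both growth estimates for the algebra of an oscillating set\<close>

theorem theoremC:
  fixes F :: "('f, 'm) ring_scheme" and f :: "nat \<Rightarrow> nat"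
  assumes "field F" and "subexponential f"
  shows "\<exists>(A :: ('f, nat list \<Rightarrow> 'f) module) V.
    assoc_algebra F A \<and> noncomm_domain A \<and>
    fin_dim_generating_subspace F A V \<and>
    (\<exists>\<^sub>\<infinity>n. growth F A V n \<ge> f n) \<and>
    (\<forall>\<epsilon>>0. \<exists>\<^sub>\<infinity>n. real (growth F A V n) \<le> exp (real n powr (3/4 + \<epsilon>)))"
proof -
  obtain X where lower: "\<exists>\<^sub>\<infinity>n. f n \<le> card {w. sparse X w \<and> length w = n}"
    and upper: "\<exists>\<^sub>\<infinity>t. \<exists>C. (\<forall>m\<le>t ^ 3. card {w. w \<noteq> [] \<and> nf X w = w \<and> length w = m} \<le> C * m)
      \<and> real ((t ^ 3 + 1) ^ (C * t ^ 2) * (C * t ^ 6 + 1) ^ (t ^ 2)) \<le> exp (real t powr (9/4))"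
    using exists_oscillating_set[OF assms(2)] by blast
  obtain A :: "('f, nat list \<Rightarrow> 'f) module" and V
    where A: "assoc_algebra F A" "noncomm_domain A" "fin_dim_generating_subspace F A V"
      and ge: "\<And>n. 0 < n \<Longrightarrow> card {w. sparse X w \<and> length w = n} \<le> growth F A V n"
      and le: "\<And>n. growth F A V n \<le> card {\<mu>. set_mset \<mu> \<subseteq> codes X \<and> (\<Sum>x\<in>#\<mu>. wlen x) \<le> n}"
    using exists_domain_of_sparse_words[OF assms(1), of X] by blast
  have "\<exists>\<^sub>\<infinity>n. growth F A V n \<ge> f n"
    unfolding INFM_nat
  proof
    fix m
    obtain n where "m < n" "f n \<le> card {w. sparse X w \<and> length w = n}"
      using lower unfolding INFM_nat by blast
    then show "\<exists>n>m. f n \<le> growth F A V n" using ge[of n] by (intro exI[of _ n]) auto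
  qed
  moreover have "\<exists>\<^sub>\<infinity>n. real (growth F A V n) \<le> exp (real n powr (3/4 + \<epsilon>))" if "\<epsilon> > 0" for \<epsilon>
    unfolding INFM_nat
  proof
    fix m
    obtain t C where "m < t" and C: "\<And>k. k \<le> t ^ 3 \<Longrightarrow>
        card {w. w \<noteq> [] \<and> nf X w = w \<and> length w = k} \<le> C * k"
      and bound: "real ((t ^ 3 + 1) ^ (C * t ^ 2) * (C * t ^ 6 + 1) ^ (t ^ 2)) \<le> exp (real t powr (9/4))"
      using upper unfolding INFM_nat by blast
    then have "0 < t" by simp
    have eq: "{x\<in>codes X. wlen x = k} = to_nat ` {w. w \<noteq> [] \<and> nf X w = w \<and> length w = k}" for k
      by (auto simp: codes_def wlen_def)
    \<comment> \<open>The growth is evaluated at \<open>n = t ^ 3\<close>, where \<open>t\<close> to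
      the power 9/4 is \<open>n\<close> to the power 3/4.\<close>
    have "growth F A V (t ^ 3) \<le> (t ^ 3 + 1) ^ (C * t ^ 2) * (C * t ^ 6 + 1) ^ (t ^ 2)"
    proof (rule order_trans[OF le card_multisets_weight_le])
      show "finite {x\<in>codes X. wlen x = k}" for k
        by (rule finite_subset[OF _ finite_codes_wlen[of X k]]) auto
      show "card {x\<in>codes X. wlen x = k} \<le> C * k" if "k \<le> t ^ 3" for k
        unfolding eq using C[OF that] by (simp add: card_image)
    qed (rule wlen_codes)
    then have "real (growth F A V (t ^ 3)) \<le> exp (real t powr (9/4))"
      by (intro order_trans[OF _ bound]) (rule of_nat_mono)
    also have "real t powr (9/4) = real (t ^ 3) powr (3/4)"
    proof -
      have "real (t ^ 3) = real t powr 3" using \<open>0 < t\<close> by simp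
      then show ?thesis by (simp only: powr_powr) simp
    qed
    also have "exp \<dots> \<le> exp (real (t ^ 3) powr (3/4 + \<epsilon>))"
      using \<open>0 < t\<close> that by (simp add: powr_mono)
    finally have "real (growth F A V (t ^ 3)) \<le> exp (real (t ^ 3) powr (3/4 + \<epsilon>))" .
    moreover have "m < t ^ 3" using \<open>m < t\<close> self_le_power[of t 3] \<open>0 < t\<close> by linarith
    ultimately show "\<exists>n>m. real (growth F A V n) \<le> exp (real n powr (3/4 + \<epsilon>))" by blast
  qed
  ultimately show ?thesis using A by (intro exI conjI allI impI)
qed

end
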